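(* Let $N$ be a positive integer multiple of $4$, let $h = 2\pi/N$, and consider the uniform periodic grid $x_j = jh$, $j = 0,1,\dots,N-1$. For a $2\pi$-periodic function $f$ with grid values $f_j = f(x_j)$, define the multi-level finite difference operator acting on all grid values by $$D^1_{\mathbf{ML}}[f]_j = -\frac{2}{N^2}\sum_{\substack{1\le d\le N/2-1\\ d\ \mathrm{odd}}} C_d \sum_{\substack{1\le \ell\le N/2-1\\ \ell\ \mathrm{odd}}} S_\ell^{-2}\left(D^2_{j+d,\ell}[f] - D^2_{j-d,\ell}[f]\right),$$ where $$C_d = \cot\left(\frac{hd}{2}\right),\qquad S_\ell = \frac{\sin(h\ell/2)}{h\ell},\qquad D^2_{k,\ell}[f] = \frac{f_{k-\ell}-2f_k+f_{k+\ell}}{(\ell h)^2},$$ and all grid indices are taken modulo $N$. Then, for $2\pi$-periodic $f\in\mathcal{C}^m$, the operator $D^1_{\mathbf{ML}}[f]_j$ approximates the first derivative $f'(x_j)$ with spectral accuracy as $N\to\infty$ through multiples of $4$; that is, the error $E_N[f] = \max_{0\le j\le N-1}\left|f'(x_j) - D^1_{\mathbf{ML}}[f]_j\right|$ has no fixed algebraic rate but depends on the regularity of $f$ in the following sense: (i) there is a sequence of exponents $p(m)$ with $p(m)\to\infty$ as $m\to\infty$ such that for every $m\ge 1$ and every $2\pi$-periodic $f\in \mathcal{C}^m$ one has $E_N[f] = \mathcal{O}(h^{p(m)})$ as $h\to 0$; (ii) if $f$ is $2\pi$-periodic and real analytic, then $E_N[f]$ decays exponentially, i.e. there are constants $K,a>0$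 depending on $f$ with $E_N[f]\le K e^{-aN}$ for all such $N$; (iii) if $f$ is band-limited (a trigonometric polynomial), then $E_N[f]=0$ (in exact arithmetic) for all sufficiently large such $N$.
   Context: Functions are $2\pi$-periodic and the grid is periodic, so grid values satisfy $f_{k+N}=f_k$; an index outside $\{0,1,\dots,N-1\}$ is renumbered by adding or subtracting $N$. $\mathcal{C}^m$ denotes $m$ times continuously differentiable functions. The operator $D^2_{k,\ell}$ is the standard centered second-order difference for the second derivative at node $x_k$ on the grid of spacing $\ell h$ (resolution level $\ell$). Spectral accuracy means that the error of the numerical method depends on the smoothness of the function: the order of convergence is not fixed and improves with the function's regularity; the error decays exponentially if the function is analytic; and the method is exact up to roundoff error if the function is band-limited. *)

theory Defs
  imports "HOL-Analysis.Analysis" "HOL-Library.Landau_Symbols" "HOL-Library.Periodic_Fun"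
begin

definition mesh :: "nat \<Rightarrow> real" where
  "mesh N = 2 * pi / real N"

definition node :: "nat \<Rightarrow> nat \<Rightarrow> real" where
  "node N j = real j * mesh N"

text \<open>Only the \<open>N\<close> samples of \<open>f\<close> in one period are read; arbitrary integer indices are reduced
  modulo \<open>N\<close>.\<close>
definition grid_val :: "nat \<Rightarrow> (real \<Rightarrow> real) \<Rightarrow> int \<Rightarrow> real" where
  "grid_val N f k = f (node N (nat (k mod int N)))"

definition D2 :: "nat \<Rightarrow> nat \<Rightarrow> (real \<Rightarrow> real) \<Rightarrow> int \<Rightarrow> real" where
  "D2 N l f k = (grid_val N f (k - int l) - 2 * grid_val N f k + grid_val N f (k + int l))
                  / (real l * mesh N)^2"

definition C_coeff :: "nat \<Rightarrow> nat \<Rightarrow> real" where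
  "C_coeff N d = cot (mesh N * real d / 2)"

definition S_coeff :: "nat \<Rightarrow> nat \<Rightarrow> real" where
  "S_coeff N l = sin (mesh N * real l / 2) / (mesh N * real l)"

definition D1_multilevel :: "nat \<Rightarrow> (real \<Rightarrow> real) \<Rightarrow> nat \<Rightarrow> real" where
  "D1_multilevel N f j = - (2 / (real N)^2) *
     (\<Sum>d \<in> {d \<in> {1..N div 2 - 1}. odd d}. C_coeff N d *
       (\<Sum>l \<in> {l \<in> {1..N div 2 - 1}. odd l}.
          (1 / (S_coeff N l)^2) * (D2 N l f (int j + int d) - D2 N l f (int j - int d))))"

definition E_err :: "(real \<Rightarrow> real) \<Rightarrow> nat \<Rightarrow> real" where
  "E_err f N = Max ((\<lambda>j. \<bar>deriv f (node N j) - D1_multilevel N f j\<bar>) ` {0..<N})"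

definition times_cont_diff :: "nat \<Rightarrow> (real \<Rightarrow> real) \<Rightarrow> bool" where
  "times_cont_diff m f \<longleftrightarrow>
     (\<forall>k<m. (deriv ^^ k) f differentiable_on UNIV) \<and> continuous_on UNIV ((deriv ^^ m) f)"

definition real_analytic :: "(real \<Rightarrow> real) \<Rightarrow> bool" where
  "real_analytic f \<longleftrightarrow>
     (\<forall>x0. \<exists>r>0. \<exists>a. \<forall>x. \<bar>x - x0\<bar> < r \<longrightarrow> (\<lambda>n. a n * (x - x0)^n) sums f x)"

definition trig_polynomial :: "(real \<Rightarrow> real) \<Rightarrow> bool" where
  "trig_polynomial f \<longleftrightarrow>
     (\<exists>(n::nat) a b. \<forall>x. f x = (\<Sum>k\<le>n. a k * cos (real k * x) + b k * sin (real k * x)))"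

text \<open>The filter \<open>N \<rightarrow> \<infinity>\<close> through multiples of \<open>4\<close>.\<close>
definition mult4_at_top :: "nat filter" where
  "mult4_at_top = inf at_top (principal {N. 4 dvd N})"

end

theory Submission
  imports Defs
begin

text \<open>
  Write \<open>N = 4 M\<close> and \<open>h = 2 \<pi> / N\<close>. The operator is translation invariant on the grid, so it acts
  diagonally on waves. On \<open>cos (k x + \<phi>)\<close> the second difference at level \<open>l\<close> produces the factor
  \<open>- 4 sin\<^sup>2 (k l h / 2)\<close>, the weight \<open>S\<^sub>l\<close> turns this into a value of the Fejer kernel at the
  odd grid angle \<open>l h\<close>, and the difference over \<open>j \<plusminus> d\<close> produces \<open>sin (k d h)\<close>, to be summed against
  \<open>cot (d h / 2)\<close>. Both kernels are short cosine sums, and \<open>cos (m l h)\<close> summed over the odd \<open>l\<close> vanishes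
  for \<open>0 < m < N / 2\<close>. Hence the inner sum equals \<open>k M\<close> and the outer sum equals \<open>M\<close>: the factors combine
  to exactly the derivative of the wave for all \<open>k < N / 2\<close> (\<open>D1_multilevel_cos\<close>). The operator is thus
  spectral differentiation in disguise, and trigonometric polynomials are differentiated exactly as soon
  as \<open>N / 2\<close> exceeds their degree.

  For other functions, let \<open>T\<close> be the Fourier partial sum of degree \<open>N / 2 - 1\<close>. Exactness on \<open>T\<close> gives
  \[ f'(x_j) - D[f]_j = (f' - T')(x_j) - D[f - T]_j . \]
  Two facts bound the right-hand side. First, \<open>D\<close> maps a function bounded by \<open>s\<close> to values bounded by
  \<open>(N / 2)\<^sup>2 s\<close> (\<open>D1_multilevel_stable\<close>); the sums of \<open>1 / sin\<^sup>2\<close> that this requires are again Fejer sums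
  and are known exactly. Second, if \<open>\<bar>f\<^sup>(\<^sup>m\<^sup>)\<bar> \<le> B\<close>, integration by parts bounds the Fourier coefficients by
  \<open>2 B / k\<^sup>m\<close>, and this controls both \<open>f - T\<close> and \<open>f' - T'\<close>, because \<open>T'\<close> is the partial sum of \<open>f'\<close>
  (\<open>fourier_truncation_error\<close>). That the Fourier series converges to \<open>f\<close> at all rests on the uniqueness
  theorem for Fourier coefficients, proved with powers of a trigonometric peak kernel.

  The outcome is \<open>E_err_smooth\<close>: for \<open>m = q + 3\<close> the error is at most a universal constant times
  \<open>B (N / 2) / (N / 2)\<^sup>q\<close>. For fixed \<open>m\<close> this is the algebraic rate \<open>p(m) = m - 4\<close>. For analytic \<open>f\<close> one has
  \<open>B \<le> C m! R\<^sup>m\<close> by compactness of a period, and choosing \<open>q\<close> proportional to \<open>N\<close> makes the bound decay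
  exponentially.
\<close>

section \<open>Trigonometric sums over odd grid angles\<close>

text \<open>Multiplied by \<open>2 sin \<alpha>\<close>, the sum telescopes to \<open>sin (2 M \<alpha>)\<close>.\<close>
lemma sum_cos_odd_multiples:
  fixes \<alpha> :: real
  assumes "sin (2 * real M * \<alpha>) = 0" "sin \<alpha> \<noteq> 0"
  shows "(\<Sum>i<M. cos (real (2 * i + 1) * \<alpha>)) = 0"
proof -
  have "2 * sin \<alpha> * (\<Sum>i<M. cos (real (2 * i + 1) * \<alpha>))
      = (\<Sum>i<M. sin (2 * real (Suc i) * \<alpha>) - sin (2 * real i * \<alpha>))"
    unfolding sum_distrib_left
  proof (rule sum.cong[OF refl])
    fix i assume "i \<in> {..<M}"
    have "2 * real (Suc i) * \<alpha> = real (2 * i + 1) * \<alpha> + \<alpha>"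
         "2 * real i * \<alpha> = real (2 * i + 1) * \<alpha> - \<alpha>" by (simp_all add: algebra_simps)
    then show "2 * sin \<alpha> * cos (real (2 * i + 1) * \<alpha>)
       = sin (2 * real (Suc i) * \<alpha>) - sin (2 * real i * \<alpha>)"
      by (simp only: sin_add sin_diff) simp
  qed
  also have "\<dots> = sin (2 * real M * \<alpha>) - sin (2 * real 0 * \<alpha>)"
    by (rule sum_lessThan_telescope)
  finally show ?thesis using assms by simp
qed

text \<open>For \<open>N = 4 M\<close> and \<open>i < M\<close> these are the angles \<open>l h\<close> with \<open>l = 2 i + 1\<close> odd and below \<open>N / 2\<close>, which
  is the index set of both sums in the operator.\<close>
definition odd_angle :: "nat \<Rightarrow> nat \<Rightarrow> real" where
  "odd_angle M i = real (2 * i + 1) * pi / (2 * real M)"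

lemma odd_angle_half_bounds:
  assumes "i < M"
  shows "0 < odd_angle M i / 2" "odd_angle M i / 2 < pi / 2"
proof -
  have "real (2 * i + 1) < 2 * real M" using assms by linarith
  then have "real (2 * i + 1) * pi < 2 * real M * pi" by simp
  then show "odd_angle M i / 2 < pi / 2" "0 < odd_angle M i / 2"
    using assms by (simp_all add: odd_angle_def field_simps add_pos_nonneg)
qed

lemma sin_half_odd_angle_pos: "i < M \<Longrightarrow> 0 < sin (odd_angle M i / 2)"
  using odd_angle_half_bounds[of i M] by (intro sin_gt_zero) auto

text \<open>This orthogonality relation is the source of exactness: it removes every frequency except \<open>0\<close> from
  the kernels below. It stops at \<open>m = 2 M\<close>, where the denominator of the telescoped sum vanishes.\<close>
lemma sum_cos_odd_angle:
  assumes "0 < m" "m < 2 * M"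
  shows "(\<Sum>i<M. cos (real m * odd_angle M i)) = 0"
proof -
  let ?\<alpha> = "real m * pi / (2 * real M)"
  have M: "M > 0" using assms by linarith
  have "sin (2 * real M * ?\<alpha>) = 0" using M by (simp add: sin_npi)
  moreover have "sin ?\<alpha> > 0"
  proof (rule sin_gt_zero)
    show "0 < ?\<alpha>" using assms M by simp
    have "real m < 2 * real M" using assms by linarith
    then show "?\<alpha> < pi" using M by (simp add: field_simps)
  qed
  ultimately have "(\<Sum>i<M. cos (real (2 * i + 1) * ?\<alpha>)) = 0"
    by (intro sum_cos_odd_multiples) auto
  then show ?thesis by (simp add: odd_angle_def mult_ac)
qed

text \<open>The summand is \<open>k\<close> times the Fejer kernel of order \<open>k\<close>, sampled at the odd grid angles.\<close>
definition fejer_sum :: "nat \<Rightarrow> nat \<Rightarrow> real" where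
  "fejer_sum M k = (\<Sum>i<M. (sin (real k * odd_angle M i / 2))\<^sup>2 / (sin (odd_angle M i / 2))\<^sup>2)"

text \<open>As a function of \<open>k\<close> the summand is a second antidifference of \<open>2 cos (k \<theta>)\<close>. This recurrence
  replaces the expansion of the kernel into a double cosine sum.\<close>
lemma fejer_second_difference:
  fixes \<theta> :: real
  assumes "sin (\<theta> / 2) \<noteq> 0"
  shows "(sin (real (Suc (Suc k)) * \<theta> / 2))\<^sup>2 / (sin (\<theta> / 2))\<^sup>2
       = 2 * ((sin (real (Suc k) * \<theta> / 2))\<^sup>2 / (sin (\<theta> / 2))\<^sup>2)
         - (sin (real k * \<theta> / 2))\<^sup>2 / (sin (\<theta> / 2))\<^sup>2 + 2 * cos (real (Suc k) * \<theta>)"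
proof -
  define x where "x = real (Suc k) * \<theta> / 2"
  have eqs: "real (Suc (Suc k)) * \<theta> / 2 = x + \<theta> / 2" "real k * \<theta> / 2 = x - \<theta> / 2"
    "real (Suc k) * \<theta> = 2 * x"
    by (simp_all add: x_def field_simps)
  have c: "(cos (\<theta> / 2))\<^sup>2 = 1 - (sin (\<theta> / 2))\<^sup>2" by (simp add: cos_squared_eq)
  have cx: "(cos x)\<^sup>2 = 1 - (sin x)\<^sup>2" by (simp add: cos_squared_eq)
  have "(sin (x + \<theta> / 2))\<^sup>2 + (sin (x - \<theta> / 2))\<^sup>2
      = 2 * ((sin x)\<^sup>2 * (cos (\<theta> / 2))\<^sup>2 + (cos x)\<^sup>2 * (sin (\<theta> / 2))\<^sup>2)"
    unfolding sin_add sin_diff by (simp add: power2_eq_square algebra_simps)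
  also have "\<dots> = 2 * (sin x)\<^sup>2 + 2 * (1 - 2 * (sin x)\<^sup>2) * (sin (\<theta> / 2))\<^sup>2"
    unfolding c cx by (simp add: algebra_simps)
  also have "1 - 2 * (sin x)\<^sup>2 = cos (2 * x)" by (simp add: cos_double_sin)
  finally have "(sin (x + \<theta> / 2))\<^sup>2 + (sin (x - \<theta> / 2))\<^sup>2
     = 2 * (sin x)\<^sup>2 + 2 * cos (2 * x) * (sin (\<theta> / 2))\<^sup>2" .
  then have "(sin (x + \<theta> / 2))\<^sup>2
     = 2 * (sin x)\<^sup>2 - (sin (x - \<theta> / 2))\<^sup>2 + 2 * cos (2 * x) * (sin (\<theta> / 2))\<^sup>2" by simp
  then show ?thesis unfolding eqs using assms
    by (simp only:) (simp add: add_divide_distrib diff_divide_distrib)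
qed

text \<open>By the recurrence and the orthogonality relation the second difference in \<open>k\<close> vanishes up to
  \<open>k = 2 M\<close>, so the sum is linear in \<open>k\<close>. The end point \<open>k = 2 M\<close> is included because only frequencies
  strictly below it enter; the stability estimate depends on this case.\<close>
lemma fejer_sum_eq:
  assumes "k \<le> 2 * M"
  shows "fejer_sum M k = real k * real M"
  using assms
proof (induction k rule: less_induct)
  case (less k)
  consider "k = 0" | "k = 1" | k' where "k = Suc (Suc k')"
    by (metis One_nat_def not0_implies_Suc)
  then show ?case
  proof cases
    case 1 then show ?thesis by (simp add: fejer_sum_def)
  next
    case 2
    have "fejer_sum M 1 = (\<Sum>i<M. 1)" unfolding fejer_sum_def
      by (rule sum.cong) (use sin_half_odd_angle_pos in force)+
    then show ?thesis using 2 by simp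
  next
    case (3 k')
    have "fejer_sum M k = 2 * fejer_sum M (Suc k') - fejer_sum M k' + 2 * (\<Sum>i<M. cos (real (Suc k') * odd_angle M i))"
      unfolding fejer_sum_def 3 sum_distrib_left sum_subtractf[symmetric] sum.distrib[symmetric]
      by (rule sum.cong[OF refl], rule fejer_second_difference)
        (use sin_half_odd_angle_pos in force)
    also have "(\<Sum>i<M. cos (real (Suc k') * odd_angle M i)) = 0"
      using less.prems 3 by (intro sum_cos_odd_angle) auto
    finally show ?thesis using less.IH[of "Suc k'"] less.IH[of k'] less.prems 3
      by (simp add: algebra_simps)
  qed
qed

text \<open>Raising \<open>k\<close> by one adds \<open>cos (k \<theta>) + cos ((k + 1) \<theta>)\<close> to the summand. Orthogonality kills both
  terms except for \<open>cos 0\<close>, which contributes \<open>M\<close> once, in the step to \<open>k = 1\<close>.\<close>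
lemma cot_sum_eq:
  assumes "0 < k" "k < 2 * M"
  shows "(\<Sum>i<M. cot (odd_angle M i / 2) * sin (real k * odd_angle M i)) = real M"
  using assms
proof (induction k)
  case 0 then show ?case by simp
next
  case (Suc k)
  have step: "cot (\<theta> / 2) * sin (real (Suc k) * \<theta>)
       = cot (\<theta> / 2) * sin (real k * \<theta>) + cos (real k * \<theta>) + cos (real (Suc k) * \<theta>)"
    if "sin (\<theta> / 2) \<noteq> 0" for \<theta> :: real
  proof -
    define y where "y = real k * \<theta> + \<theta> / 2"
    have eqs: "real (Suc k) * \<theta> = y + \<theta> / 2" "real k * \<theta> = y - \<theta> / 2"
      by (simp_all add: y_def field_simps)
    have "sin (y + \<theta> / 2) = sin (y - \<theta> / 2) + 2 * cos y * sin (\<theta> / 2)"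
      "cos (y - \<theta> / 2) + cos (y + \<theta> / 2) = 2 * cos y * cos (\<theta> / 2)"
      unfolding sin_add sin_diff cos_add cos_diff by simp_all
    moreover have "cot (\<theta> / 2) * (2 * cos y * sin (\<theta> / 2)) = 2 * cos y * cos (\<theta> / 2)"
      using that by (simp add: cot_def)
    ultimately show ?thesis unfolding eqs by (simp only: distrib_left)
  qed
  have "(\<Sum>i<M. cot (odd_angle M i / 2) * sin (real (Suc k) * odd_angle M i))
     = (\<Sum>i<M. cot (odd_angle M i / 2) * sin (real k * odd_angle M i))
     + (\<Sum>i<M. cos (real k * odd_angle M i)) + (\<Sum>i<M. cos (real (Suc k) * odd_angle M i))"
    unfolding sum.distrib[symmetric]
    by (rule sum.cong[OF refl], rule step) (use sin_half_odd_angle_pos in force)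
  also have "\<dots> = real M"
  proof (cases "k = 0")
    case True
    then show ?thesis using Suc.prems sum_cos_odd_angle[of 1 M] by simp
  next
    case False
    then show ?thesis using Suc sum_cos_odd_angle[of k M] sum_cos_odd_angle[of "Suc k" M] by simp
  qed
  finally show ?case .
qed

section \<open>The multi-level operator: linearity, exactness and stability\<close>

lemma sum_odd_reindex:
  fixes N M :: nat and g :: "nat \<Rightarrow> real"
  assumes "N = 4 * M"
  shows "(\<Sum>l \<in> {l \<in> {1..N div 2 - 1}. odd l}. g l) = (\<Sum>i<M. g (2 * i + 1))"
proof -
  have "{l \<in> {1..N div 2 - 1}. odd l} = (\<lambda>i. 2 * i + 1) ` {..<M}"
  proof (intro set_eqI iffI)
    fix l assume "l \<in> {l \<in> {1..N div 2 - 1}. odd l}"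
    then obtain i where "l = 2 * i + 1" "l \<le> 2 * M - 1" using assms by (auto elim!: oddE)
    then show "l \<in> (\<lambda>i. 2 * i + 1) ` {..<M}" by auto
  qed (use assms in auto)
  then show ?thesis by (simp add: sum.reindex inj_on_def)
qed

text \<open>The difference is left undivided because the factor \<open>(l h)\<^sup>2\<close> cancels against \<open>S\<^sub>l\<close>.\<close>
definition second_diff :: "nat \<Rightarrow> (real \<Rightarrow> real) \<Rightarrow> nat \<Rightarrow> int \<Rightarrow> real" where
  "second_diff N f l k = grid_val N f (k - int l) - 2 * grid_val N f k + grid_val N f (k + int l)"

lemma D1_multilevel_eq:
  assumes "N = 4 * M" "M > 0"
  shows "D1_multilevel N f j = - (2 / (real N)^2) *
     (\<Sum>d<M. cot (odd_angle M d / 2) *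
       (\<Sum>l<M. (second_diff N f (2 * l + 1) (int j + int (2 * d + 1)) - second_diff N f (2 * l + 1) (int j - int (2 * d + 1)))
                / (sin (odd_angle M l / 2))\<^sup>2))"
proof -
  have h: "mesh N * real (2 * i + 1) / 2 = odd_angle M i / 2" for i
    using assms by (simp add: mesh_def odd_angle_def field_simps)
  have cancel: "1 / (s / p)\<^sup>2 * (u / (q)\<^sup>2 - v / (q)\<^sup>2) = (u - v) / s\<^sup>2" if "p \<noteq> 0" "p = q" for s p q u v :: real
    using that by (simp add: power_divide divide_simps)
  have l: "1 / (S_coeff N (2*l+1))^2 * (D2 N (2*l+1) f k - D2 N (2*l+1) f k') = (second_diff N f (2*l+1) k - second_diff N f (2*l+1) k') / (sin (odd_angle M l / 2))\<^sup>2"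
    for l k k'
    unfolding S_coeff_def D2_def second_diff_def h
    by (rule cancel) (use assms in \<open>auto simp: mesh_def\<close>)
  show ?thesis
    unfolding D1_multilevel_def sum_odd_reindex[OF assms(1)] l C_coeff_def h ..
qed

lemma D1_multilevel_add:
  "D1_multilevel N (\<lambda>x. f x + g x) j = D1_multilevel N f j + D1_multilevel N g j"
proof -
  have D2: "D2 N l (\<lambda>x. f x + g x) k = D2 N l f k + D2 N l g k" for l k
    by (simp add: D2_def grid_val_def add_divide_distrib diff_divide_distrib algebra_simps)
  show ?thesis
    unfolding D1_multilevel_def distrib_left[symmetric] sum.distrib[symmetric] D2
    by (simp only: algebra_simps)
qed

lemma D1_multilevel_scale:
  "D1_multilevel N (\<lambda>x. c * f x) j = c * D1_multilevel N f j"
proof -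
  have D2: "D2 N l (\<lambda>x. c * f x) k = c * D2 N l f k" for l k
    by (simp add: D2_def grid_val_def add_divide_distrib diff_divide_distrib algebra_simps)
  show ?thesis
    unfolding D1_multilevel_def sum_distrib_left D2
    by (simp only: algebra_simps)
qed

lemma D1_multilevel_sum:
  "finite A \<Longrightarrow> D1_multilevel N (\<lambda>x. \<Sum>k\<in>A. f k x) j = (\<Sum>k\<in>A. D1_multilevel N (f k) j)"
proof (induction A rule: finite_induct)
  case empty
  show ?case using D1_multilevel_scale[of N 0 "\<lambda>_. 0" j] by simp
qed (simp add: D1_multilevel_add)

lemma D1_multilevel_diff:
  "D1_multilevel N (\<lambda>x. f x - g x) j = D1_multilevel N f j - D1_multilevel N g j"
  using D1_multilevel_add[of N f "\<lambda>x. - 1 * g x" j] D1_multilevel_scale[of N "- 1" g j] by simp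

lemma grid_val_periodic:
  assumes "periodic_fun_simple f (2 * pi)" "N > 0"
  shows "grid_val N f k = f (real_of_int k * mesh N)"
proof -
  interpret periodic_fun_simple f "2 * pi" by fact
  have "real (nat (k mod int N)) = real_of_int (k mod int N)" using assms(2) by simp
  also have "\<dots> = real_of_int k - real N * real_of_int (k div int N)"
    unfolding minus_mult_div_eq_mod[symmetric] by simp
  finally have "node N (nat (k mod int N)) = real_of_int k * mesh N - real_of_int (k div int N) * (2 * pi)"
    using assms(2) by (simp add: node_def mesh_def left_diff_distrib diff_divide_distrib)
  then show ?thesis by (simp add: grid_val_def minus_of_int)
qed

lemma periodic_cos_wave: "periodic_fun_simple (\<lambda>x. cos (real k * x + \<phi>)) (2 * pi)"
proof
  fix x :: real
  show "cos (real k * (x + 2 * pi) + \<phi>) = cos (real k * x + \<phi>)"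
    using cos.plus_of_nat[of "real k * x + \<phi>" k] by (simp add: algebra_simps)
qed

lemma second_diff_cos:
  fixes k :: nat and \<phi> :: real
  assumes "N > 0"
  shows "second_diff N (\<lambda>x. cos (real k * x + \<phi>)) l p
       = - 4 * (sin (real k * (real l * mesh N) / 2))\<^sup>2 * cos (real k * (real_of_int p * mesh N) + \<phi>)"
proof -
  define y w where "y = real k * (real_of_int p * mesh N) + \<phi>" and "w = real k * (real l * mesh N) / 2"
  have "second_diff N (\<lambda>x. cos (real k * x + \<phi>)) l p = cos (y - 2 * w) - 2 * cos y + cos (y + 2 * w)"
    unfolding second_diff_def grid_val_periodic[OF periodic_cos_wave assms] y_def w_def
    by (simp add: algebra_simps)
  also have "\<dots> = - 2 * cos y * (1 - cos (2 * w))" by (simp add: cos_add cos_diff algebra_simps)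
  also have "1 - cos (2 * w) = 2 * (sin w)\<^sup>2" by (simp add: cos_double_sin)
  finally show ?thesis by (simp add: y_def w_def)
qed

text \<open>The product \<open>8 sin y \<sqdot> k M \<sqdot> M\<close> of the two kernel sums, scaled by \<open>2 / N\<^sup>2 = 1 / (8 M\<^sup>2)\<close>, gives
  \<open>k sin y\<close>. An arbitrary phase \<open>\<phi>\<close> treats sine and cosine together.\<close>
lemma D1_multilevel_cos:
  assumes N: "N = 4 * M" "M > 0" and k: "k < 2 * M"
  shows "D1_multilevel N (\<lambda>x. cos (real k * x + \<phi>)) j = - real k * sin (real k * node N j + \<phi>)"
proof (cases "k = 0")
  case True
  have "second_diff N (\<lambda>x. cos (real k * x + \<phi>)) l p = 0" for l p
    unfolding True by (simp add: second_diff_def grid_val_def)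
  then show ?thesis by (simp add: D1_multilevel_eq[OF N] True)
next
  case False
  have h: "real (2 * i + 1) * mesh N = odd_angle M i" for i
    using N by (simp add: mesh_def odd_angle_def field_simps)
  define y where "y = real k * node N j + \<phi>"
  have diff: "second_diff N (\<lambda>x. cos (real k * x + \<phi>)) (2 * l + 1) (int j + int (2 * d + 1))
            - second_diff N (\<lambda>x. cos (real k * x + \<phi>)) (2 * l + 1) (int j - int (2 * d + 1))
            = 8 * sin y * sin (real k * odd_angle M d) * (sin (real k * odd_angle M l / 2))\<^sup>2" for l d
  proof -
    define z where "z = real k * odd_angle M d"
    have 1: "real k * (real_of_int (int j + int (2 * d + 1)) * mesh N) + \<phi> = y + z"
      "real k * (real_of_int (int j - int (2 * d + 1)) * mesh N) + \<phi> = y - z"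
      unfolding y_def z_def node_def h[symmetric] by (simp_all add: algebra_simps)
    have N0: "N > 0" using N by simp
    show ?thesis
      unfolding second_diff_cos[OF N0] 1 h z_def[symmetric] by (simp add: cos_add cos_diff algebra_simps)
  qed
  have "D1_multilevel N (\<lambda>x. cos (real k * x + \<phi>)) j = - (2 / (real N)^2) *
     (\<Sum>d<M. cot (odd_angle M d / 2) * (8 * sin y * sin (real k * odd_angle M d) * fejer_sum M k))"
    unfolding D1_multilevel_eq[OF N] diff fejer_sum_def sum_distrib_left by (simp only: times_divide_eq_right)
  also have "(\<Sum>d<M. cot (odd_angle M d / 2) * (8 * sin y * sin (real k * odd_angle M d) * fejer_sum M k))
      = 8 * sin y * fejer_sum M k * (\<Sum>d<M. cot (odd_angle M d / 2) * sin (real k * odd_angle M d))"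
    unfolding sum_distrib_left by (simp only: mult_ac)
  also have "\<dots> = 8 * sin y * (real k * real M) * real M"
    using k False by (simp add: fejer_sum_eq cot_sum_eq)
  finally show ?thesis using N by (simp add: y_def power2_eq_square field_simps)
qed

definition trig_sum :: "(nat \<Rightarrow> real) \<Rightarrow> (nat \<Rightarrow> real) \<Rightarrow> nat \<Rightarrow> real \<Rightarrow> real" where
  "trig_sum a b n x = (\<Sum>k\<le>n. a k * cos (real k * x) + b k * sin (real k * x))"

lemma trig_sum_has_derivative:
  "(trig_sum a b n has_real_derivative trig_sum (\<lambda>k. real k * b k) (\<lambda>k. - real k * a k) n x) (at x)"
proof -
  have "((\<lambda>x. \<Sum>k\<le>n. a k * cos (real k * x) + b k * sin (real k * x)) has_real_derivative
     (\<Sum>k\<le>n. a k * (- sin (real k * x) * real k) + b k * (cos (real k * x) * real k))) (at x)"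
    by (rule DERIV_sum) (auto intro!: derivative_eq_intros)
  moreover have "(\<Sum>k\<le>n. a k * (- sin (real k * x) * real k) + b k * (cos (real k * x) * real k))
     = trig_sum (\<lambda>k. real k * b k) (\<lambda>k. - real k * a k) n x"
    unfolding trig_sum_def by (rule sum.cong) (simp_all add: algebra_simps)
  ultimately show ?thesis by (simp only: trig_sum_def[abs_def])
qed

lemma D1_multilevel_trig_sum:
  assumes N: "N = 4 * M" "M > 0" and n: "n < 2 * M"
  shows "D1_multilevel N (trig_sum a b n) j = deriv (trig_sum a b n) (node N j)"
proof -
  have wave: "D1_multilevel N (\<lambda>x. a k * cos (real k * x) + b k * sin (real k * x)) j
     = real k * b k * cos (real k * node N j) + - real k * a k * sin (real k * node N j)"
    if "k \<le> n" for k
  proof -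
    have k: "k < 2 * M" using that n by simp
    \<comment> \<open>sine terms are cosine waves of phase \<open>- \<pi> / 2\<close>\<close>
    have s: "sin t = cos (t + - (pi / 2))" for t :: real
      unfolding cos_add by simp
    show ?thesis
      using D1_multilevel_cos[OF N k, of 0 j] D1_multilevel_cos[OF N k, of "- (pi / 2)" j]
      unfolding D1_multilevel_add D1_multilevel_scale s[symmetric]
      by (simp add: sin_diff)
  qed
  have "D1_multilevel N (trig_sum a b n) j
      = trig_sum (\<lambda>k. real k * b k) (\<lambda>k. - real k * a k) n (node N j)"
    unfolding trig_sum_def[abs_def] D1_multilevel_sum[OF finite_atMost]
    by (rule sum.cong[OF refl], rule wave) simp
  then show ?thesis by (simp add: DERIV_imp_deriv[OF trig_sum_has_derivative])
qed

text \<open>At \<open>k = 2 M\<close> all numerators \<open>sin\<^sup>2 (k \<theta> / 2)\<close> of the Fejer sum are \<open>1\<close>, since \<open>\<theta>\<close> is an odd multiple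
  of \<open>\<pi> / (2 M)\<close>. The sum of \<open>1 / sin\<^sup>2\<close> is therefore exactly \<open>2 M\<^sup>2\<close>, and it also dominates the sum of
  the cotangents.\<close>
lemma D1_multilevel_stable:
  assumes N: "N = 4 * M" "M > 0" and s: "\<And>x. \<bar>f x\<bar> \<le> s"
  shows "\<bar>D1_multilevel N f j\<bar> \<le> (2 * real M)\<^sup>2 * s"
proof -
  have s0: "0 \<le> s" using s[of 0] by linarith
  have inv: "(\<Sum>l<M. 1 / (sin (odd_angle M l / 2))\<^sup>2) = 2 * (real M)\<^sup>2"
  proof -
    have "(sin (real (2 * M) * odd_angle M l / 2))\<^sup>2 = 1" for l
    proof -
      have "real (2 * M) * odd_angle M l / 2 = real (2 * l + 1) * pi / 2"
        using N by (simp add: odd_angle_def)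
      also have "\<dots> = real l * pi + pi / 2" by (simp add: field_simps)
      finally show ?thesis by (simp add: sin_add power_mult_distrib[symmetric] flip: power_mult)
    qed
    then show ?thesis using fejer_sum_eq[of "2 * M" M] by (simp add: fejer_sum_def power2_eq_square)
  qed
  have gv: "\<bar>grid_val N f k\<bar> \<le> s" for k by (simp add: grid_val_def s)
  have sd: "\<bar>second_diff N f l k\<bar> \<le> 4 * s" for l k
    using gv[of "k - int l"] gv[of k] gv[of "k + int l"] unfolding second_diff_def by linarith
  have cot: "\<bar>cot (odd_angle M d / 2)\<bar> \<le> 1 / (sin (odd_angle M d / 2))\<^sup>2" if "d < M" for d
  proof -
    let ?t = "odd_angle M d / 2"
    have p: "0 < sin ?t" by (rule sin_half_odd_angle_pos[OF that])
    have "\<bar>cos ?t\<bar> * sin ?t \<le> 1 * 1" by (rule mult_mono) (use p in auto)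
    then show ?thesis using p by (simp add: cot_def abs_divide power2_eq_square field_simps)
  qed
  define B where "B = 8 * s * (2 * (real M)\<^sup>2)"
  have inner: "\<bar>\<Sum>l<M. (second_diff N f (2 * l + 1) p - second_diff N f (2 * l + 1) q) / (sin (odd_angle M l / 2))\<^sup>2\<bar> \<le> B" for p q
  proof -
    have "\<bar>\<Sum>l<M. (second_diff N f (2 * l + 1) p - second_diff N f (2 * l + 1) q) / (sin (odd_angle M l / 2))\<^sup>2\<bar>
       \<le> (\<Sum>l<M. 8 * s * (1 / (sin (odd_angle M l / 2))\<^sup>2))"
    proof (rule order_trans[OF sum_abs sum_mono])
      fix l
      have "\<bar>second_diff N f (2 * l + 1) p - second_diff N f (2 * l + 1) q\<bar> \<le> 8 * s"
        using sd[of "2 * l + 1" p] sd[of "2 * l + 1" q] by linarith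
      then have "\<bar>second_diff N f (2 * l + 1) p - second_diff N f (2 * l + 1) q\<bar> / (sin (odd_angle M l / 2))\<^sup>2
         \<le> 8 * s / (sin (odd_angle M l / 2))\<^sup>2"
        by (rule divide_right_mono) simp
      then show "\<bar>(second_diff N f (2 * l + 1) p - second_diff N f (2 * l + 1) q) / (sin (odd_angle M l / 2))\<^sup>2\<bar>
         \<le> 8 * s * (1 / (sin (odd_angle M l / 2))\<^sup>2)" by (simp add: abs_divide)
    qed
    also have "\<dots> = B" by (simp only: sum_distrib_left[symmetric] inv B_def)
    finally show ?thesis .
  qed
  have B0: "0 \<le> B" using s0 by (simp add: B_def)
  have "\<bar>\<Sum>d<M. cot (odd_angle M d / 2) * (\<Sum>l<M. (second_diff N f (2 * l + 1) (int j + int (2 * d + 1))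
           - second_diff N f (2 * l + 1) (int j - int (2 * d + 1))) / (sin (odd_angle M l / 2))\<^sup>2)\<bar>
      \<le> (\<Sum>d<M. 1 / (sin (odd_angle M d / 2))\<^sup>2 * B)"
    by (rule order_trans[OF sum_abs sum_mono], unfold abs_mult, rule mult_mono[OF cot inner]) auto
  then have "\<bar>D1_multilevel N f j\<bar> \<le> 2 / (real N)\<^sup>2 * (\<Sum>d<M. 1 / (sin (odd_angle M d / 2))\<^sup>2 * B)"
    unfolding D1_multilevel_eq[OF N] abs_mult by (intro mult_mono) auto
  also have "\<dots> = 2 / (real N)\<^sup>2 * (2 * (real M)\<^sup>2 * B)" by (simp only: sum_distrib_right[symmetric] inv)
  also have "\<dots> = (2 * real M)\<^sup>2 * s" using N by (simp add: B_def power2_eq_square field_simps)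
  finally show ?thesis .
qed

section \<open>Smooth periodic functions\<close>

lemma period_reduction:
  fixes x :: real
  obtains y m where "y \<in> {0..2 * pi}" "x = y + of_int m * (2 * pi)"
proof
  let ?m = "\<lfloor>x / (2 * pi)\<rfloor>"
  show "x = (x - of_int ?m * (2 * pi)) + of_int ?m * (2 * pi)" by simp
  have "of_int ?m \<le> x / (2 * pi)" "x / (2 * pi) < of_int ?m + 1"
    using floor_correct[of "x / (2 * pi)"] by auto
  then have "of_int ?m * (2 * pi) \<le> x" "x < (of_int ?m + 1) * (2 * pi)"
    by (simp_all only: pos_le_divide_eq pos_divide_less_eq pi_gt_zero mult_pos_pos zero_less_numeral)
  then show "x - of_int ?m * (2 * pi) \<in> {0..2 * pi}" by (simp add: distrib_right)
qed

lemma periodic_continuous_bounded: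
  fixes f :: "real \<Rightarrow> real"
  assumes per: "periodic_fun_simple f (2 * pi)" and cont: "continuous_on UNIV f"
  obtains M where "M > 0" "\<And>x. \<bar>f x\<bar> \<le> M"
proof -
  interpret periodic_fun_simple f "2 * pi" by (rule per)
  have "bounded (f ` {0..2 * pi})"
    using cont continuous_on_subset by (intro compact_imp_bounded compact_continuous_image compact_Icc) blast
  then obtain M where M: "M > 0" "\<And>x. x \<in> {0..2 * pi} \<Longrightarrow> \<bar>f x\<bar> \<le> M" unfolding bounded_pos by auto
  have "\<bar>f x\<bar> \<le> M" for x
  proof -
    obtain y m where "y \<in> {0..2 * pi}" "x = y + of_int m * (2 * pi)" by (rule period_reduction)
    then show ?thesis using M(2)[of y] by (simp add: plus_of_int)
  qed
  with M(1) show ?thesis by (rule that)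
qed

lemma periodic_end: "periodic_fun_simple f (2 * pi) \<Longrightarrow> f (2 * pi) = f (0::real)"
  using periodic_fun_simple.plus_period[of f "2 * pi" 0] by simp

lemma periodic_deriv:
  assumes "periodic_fun_simple f (2 * pi)"
  shows "periodic_fun_simple (deriv f) (2 * pi)"
proof
  interpret periodic_fun_simple f "2 * pi" by fact
  fix x :: real
  have "(f has_field_derivative D) (at (x + 2 * pi)) \<longleftrightarrow> (f has_field_derivative D) (at x)" for D
    using DERIV_shift[of f D x "2 * pi"] plus_period by (simp add: add.commute)
  then show "deriv f (x + 2 * pi) = deriv f x" by (simp add: deriv_def)
qed

lemma periodic_deriv_iterate:
  "periodic_fun_simple f (2 * pi) \<Longrightarrow> periodic_fun_simple ((deriv ^^ m) f) (2 * pi)"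
  by (induction m) (auto intro: periodic_deriv)

lemma times_cont_diff_Suc:
  "times_cont_diff (Suc m) f \<longleftrightarrow> f differentiable_on UNIV \<and> times_cont_diff m (deriv f)"
  unfolding times_cont_diff_def All_less_Suc2 by (simp add: funpow_swap1 o_def)

lemma times_cont_diff_continuous: "times_cont_diff m f \<Longrightarrow> continuous_on UNIV f"
  by (cases m) (auto simp: times_cont_diff_Suc differentiable_imp_continuous_on, simp add: times_cont_diff_def)

lemma times_cont_diff_antimono:
  assumes "times_cont_diff m f" "k \<le> m"
  shows "times_cont_diff k f"
  using assms
proof (induction m arbitrary: f k)
  case (Suc m)
  show ?case
  proof (cases k)
    case 0 then show ?thesis using times_cont_diff_continuous[OF Suc.prems(1)] by (simp add: times_cont_diff_def)
  next
    case (Suc k')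
    then show ?thesis using Suc.IH[of "deriv f" k'] Suc.prems by (simp add: times_cont_diff_Suc)
  qed
qed simp

lemma times_cont_diff_DERIV:
  "times_cont_diff (Suc m) f \<Longrightarrow> (f has_real_derivative deriv f x) (at x)"
  by (simp add: times_cont_diff_Suc differentiable_on_def DERIV_deriv_iff_real_differentiable)

lemma times_cont_diff_iterate:
  assumes "times_cont_diff m f" shows "continuous_on UNIV ((deriv ^^ m) f)"
  using assms by (simp add: times_cont_diff_def)

section \<open>Fourier coefficients\<close>

text \<open>Normalised so that the coefficient of index \<open>0\<close> is the mean value of the function.\<close>
definition fourier_cos :: "(real \<Rightarrow> real) \<Rightarrow> nat \<Rightarrow> real" where
  "fourier_cos f k = (if k = 0 then 1 / (2 * pi) else 1 / pi)
     * integral {0..2 * pi} (\<lambda>t. f t * cos (real k * t))"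

definition fourier_sin :: "(real \<Rightarrow> real) \<Rightarrow> nat \<Rightarrow> real" where
  "fourier_sin f k = (1 / pi) * integral {0..2 * pi} (\<lambda>t. f t * sin (real k * t))"

abbreviation fourier_sum :: "(real \<Rightarrow> real) \<Rightarrow> nat \<Rightarrow> real \<Rightarrow> real" where
  "fourier_sum f \<equiv> trig_sum (fourier_cos f) (fourier_sin f)"

lemma fourier_coeff_eq_iff:
  "fourier_cos g k = fourier_cos f k \<longleftrightarrow>
     integral {0..2 * pi} (\<lambda>t. g t * cos (real k * t)) = integral {0..2 * pi} (\<lambda>t. f t * cos (real k * t))"
  "fourier_sin g k = fourier_sin f k \<longleftrightarrow>
     integral {0..2 * pi} (\<lambda>t. g t * sin (real k * t)) = integral {0..2 * pi} (\<lambda>t. f t * sin (real k * t))"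
  by (simp_all add: fourier_cos_def fourier_sin_def)

lemma has_integral_cos_wave:
  "((\<lambda>x. cos (of_int p * x + \<gamma>)) has_integral (if p = 0 then 2 * pi * cos \<gamma> else 0)) {0..2 * pi}"
proof (cases "p = 0")
  case True
  then show ?thesis using has_integral_const_real[of "cos \<gamma>" 0 "2 * pi"] by simp
next
  case False
  have "((\<lambda>x. cos (of_int p * x + \<gamma>)) has_integral
      sin (of_int p * (2 * pi) + \<gamma>) / of_int p - sin (of_int p * 0 + \<gamma>) / of_int p) {0..2 * pi}"
  proof (rule fundamental_theorem_of_calculus)
    fix x :: real
    show "((\<lambda>x. sin (of_int p * x + \<gamma>) / of_int p) has_vector_derivative cos (of_int p * x + \<gamma>))
       (at x within {0..2 * pi})"
      unfolding has_real_derivative_iff_has_vector_derivative[symmetric]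
      using False by (auto intro!: derivative_eq_intros)
  qed simp
  moreover have "sin (of_int p * (2 * pi) + \<gamma>) = sin \<gamma>"
    using sin.plus_of_int[of \<gamma> p] by (simp add: add.commute)
  ultimately show ?thesis using False by simp
qed

lemma has_integral_sin_wave:
  "((\<lambda>x. sin (of_int p * x)) has_integral 0) {0..2 * pi}"
proof -
  have "sin t = cos (t + - (pi / 2))" for t :: real unfolding cos_add by simp
  then show ?thesis using has_integral_cos_wave[of p "- (pi / 2)"] by (simp split: if_splits)
qed

lemma has_integral_trig_products:
  fixes l k :: nat
  shows "((\<lambda>x. cos (real l * x) * cos (real k * x)) has_integral
           (if l = k then (if k = 0 then 2 * pi else pi) else 0)) {0..2 * pi}" (is ?cc)
    and "((\<lambda>x. sin (real l * x) * cos (real k * x)) has_integral 0) {0..2 * pi}" (is ?sc)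
    and "((\<lambda>x. sin (real l * x) * sin (real k * x)) has_integral
           (if l = k then (if k = 0 then 0 else pi) else 0)) {0..2 * pi}" (is ?ss)
proof -
  let ?m = "int l - int k" and ?p = "int l + int k"
  have e: "of_int ?m * x = real l * x - real k * x" "of_int ?p * x = real l * x + real k * x" for x :: real
    by (simp_all add: algebra_simps)
  have c: "((\<lambda>x. cos (of_int p * x)) has_integral (if p = 0 then 2 * pi else 0)) {0..2 * pi}" for p
    using has_integral_cos_wave[of p 0] by (simp only: add_0_right cos_zero mult_1_right)
  have "((\<lambda>x. (cos (of_int ?m * x) + cos (of_int ?p * x)) / 2) has_integral
      ((if ?m = 0 then 2 * pi else 0) + (if ?p = 0 then 2 * pi else 0)) / 2) {0..2 * pi}"
    by (intro has_integral_divide has_integral_add c)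
  moreover have "(cos (of_int ?m * x) + cos (of_int ?p * x)) / 2 = cos (real l * x) * cos (real k * x)" for x :: real
    unfolding e cos_add cos_diff by simp
  moreover have "((if ?m = 0 then 2 * pi else 0) + (if ?p = 0 then 2 * pi else 0)) / 2 = (if l = k then (if k = 0 then 2 * pi else pi) else 0)"
    by auto
  ultimately show ?cc by (simp only:)
  have "((\<lambda>x. (sin (of_int ?m * x) + sin (of_int ?p * x)) / 2) has_integral (0 + 0) / 2) {0..2 * pi}"
    by (intro has_integral_divide has_integral_add has_integral_sin_wave)
  moreover have "(sin (of_int ?m * x) + sin (of_int ?p * x)) / 2 = sin (real l * x) * cos (real k * x)" for x :: real
    unfolding e sin_add sin_diff by simp
  ultimately show ?sc by simp
  have "((\<lambda>x. (cos (of_int ?m * x) - cos (of_int ?p * x)) / 2) has_integral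
      ((if ?m = 0 then 2 * pi else 0) - (if ?p = 0 then 2 * pi else 0)) / 2) {0..2 * pi}"
    by (intro has_integral_divide has_integral_diff c)
  moreover have "(cos (of_int ?m * x) - cos (of_int ?p * x)) / 2 = sin (real l * x) * sin (real k * x)" for x :: real
    unfolding e cos_add cos_diff by simp
  moreover have "((if ?m = 0 then 2 * pi else 0) - (if ?p = 0 then 2 * pi else 0)) / 2 = (if l = k then (if k = 0 then 0 else pi) else 0)"
    by auto
  ultimately show ?ss by (simp only:)
qed

lemma fourier_cos_trig_sum:
  assumes "k \<le> n"
  shows "fourier_cos (trig_sum a b n) k = a k"
proof -
  have "((\<lambda>x. \<Sum>l\<le>n. a l * (cos (real l * x) * cos (real k * x)) + b l * (sin (real l * x) * cos (real k * x)))
     has_integral (\<Sum>l\<le>n. a l * (if l = k then (if k = 0 then 2 * pi else pi) else 0) + b l * 0)) {0..2 * pi}"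
    by (intro has_integral_sum has_integral_add has_integral_mult_right has_integral_trig_products) simp
  also have "(\<lambda>x. \<Sum>l\<le>n. a l * (cos (real l * x) * cos (real k * x)) + b l * (sin (real l * x) * cos (real k * x)))
      = (\<lambda>x. trig_sum a b n x * cos (real k * x))"
    unfolding trig_sum_def sum_distrib_right by (intro ext sum.cong) (simp_all add: algebra_simps)
  also have "(\<Sum>l\<le>n. a l * (if l = k then (if k = 0 then 2 * pi else pi) else 0) + b l * 0)
      = (\<Sum>l\<le>n. if l = k then a k * (if k = 0 then 2 * pi else pi) else 0)"
    by (intro sum.cong) auto
  also have "\<dots> = a k * (if k = 0 then 2 * pi else pi)" using assms by simp
  finally have "((\<lambda>x. trig_sum a b n x * cos (real k * x)) has_integral a k * (if k = 0 then 2 * pi else pi)) {0..2 * pi}" .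
  then have "integral {0..2 * pi} (\<lambda>x. trig_sum a b n x * cos (real k * x)) = a k * (if k = 0 then 2 * pi else pi)"
    by (rule integral_unique)
  then show ?thesis by (simp add: fourier_cos_def)
qed

lemma fourier_sin_trig_sum:
  assumes "0 < k" "k \<le> n"
  shows "fourier_sin (trig_sum a b n) k = b k"
proof -
  have "((\<lambda>x. \<Sum>l\<le>n. a l * (sin (real k * x) * cos (real l * x)) + b l * (sin (real l * x) * sin (real k * x)))
     has_integral (\<Sum>l\<le>n. a l * 0 + b l * (if l = k then (if k = 0 then 0 else pi) else 0))) {0..2 * pi}"
    by (intro has_integral_sum has_integral_add has_integral_mult_right has_integral_trig_products) simp
  also have "(\<lambda>x. \<Sum>l\<le>n. a l * (sin (real k * x) * cos (real l * x)) + b l * (sin (real l * x) * sin (real k * x)))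
      = (\<lambda>x. trig_sum a b n x * sin (real k * x))"
    unfolding trig_sum_def sum_distrib_right by (intro ext sum.cong) (simp_all add: algebra_simps)
  also have "(\<Sum>l\<le>n. a l * 0 + b l * (if l = k then (if k = 0 then 0 else pi) else 0))
      = (\<Sum>l\<le>n. if l = k then b k * pi else 0)"
    using assms by (intro sum.cong) auto
  also have "\<dots> = b k * pi" using assms by simp
  finally have "((\<lambda>x. trig_sum a b n x * sin (real k * x)) has_integral b k * pi) {0..2 * pi}" .
  then show ?thesis by (simp add: fourier_sin_def integral_unique)
qed

text \<open>Integration by parts; the boundary terms cancel by periodicity. The case \<open>k = 0\<close> says that a
  derivative has mean zero.\<close>
lemma fourier_coeff_deriv:
  assumes per: "f (2 * pi) = f 0"
    and der: "\<And>x. (f has_real_derivative f' x) (at x)" and cont: "continuous_on UNIV f'"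
  shows "fourier_cos f' k = real k * fourier_sin f k" "fourier_sin f' k = - real k * fourier_cos f k"
proof -
  have cf: "continuous_on S f" for S
    using der by (meson DERIV_continuous continuous_at_imp_continuous_on)
  have cf': "continuous_on S f'" for S using cont continuous_on_subset by blast
  have trig: "cos (real k * (2 * pi)) = 1" "sin (real k * (2 * pi)) = 0"
    using cos.plus_of_nat[of "0 :: real" k] sin.plus_of_nat[of "0 :: real" k] by simp_all
  note int = integrable_continuous_real[OF continuous_on_mult]
  note ci = cf cf' continuous_intros
  have "((\<lambda>x. f' x * cos (real k * x) - real k * (f x * sin (real k * x))) has_integral
      f (2 * pi) * cos (real k * (2 * pi)) - f 0 * cos (real k * 0)) {0..2 * pi}"
    by (rule fundamental_theorem_of_calculus)
      (auto simp: has_real_derivative_iff_has_vector_derivative[symmetric]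
        intro!: derivative_eq_intros DERIV_subset[OF der])
  then have "integral {0..2 * pi} (\<lambda>x. f' x * cos (real k * x) - real k * (f x * sin (real k * x))) = 0"
    using per trig by (simp add: integral_unique)
  moreover have "integral {0..2 * pi} (\<lambda>x. f' x * cos (real k * x) - real k * (f x * sin (real k * x)))
     = integral {0..2 * pi} (\<lambda>x. f' x * cos (real k * x)) - real k * integral {0..2 * pi} (\<lambda>x. f x * sin (real k * x))"
    by (subst integral_diff) (auto intro!: int ci)
  ultimately show "fourier_cos f' k = real k * fourier_sin f k"
    by (simp add: fourier_cos_def fourier_sin_def)
  have "((\<lambda>x. f' x * sin (real k * x) + real k * (f x * cos (real k * x))) has_integral
      f (2 * pi) * sin (real k * (2 * pi)) - f 0 * sin (real k * 0)) {0..2 * pi}"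
    by (rule fundamental_theorem_of_calculus)
      (auto simp: has_real_derivative_iff_has_vector_derivative[symmetric]
        intro!: derivative_eq_intros DERIV_subset[OF der])
  then have "integral {0..2 * pi} (\<lambda>x. f' x * sin (real k * x) + real k * (f x * cos (real k * x))) = 0"
    using per trig by (simp add: integral_unique)
  moreover have "integral {0..2 * pi} (\<lambda>x. f' x * sin (real k * x) + real k * (f x * cos (real k * x)))
     = integral {0..2 * pi} (\<lambda>x. f' x * sin (real k * x)) + real k * integral {0..2 * pi} (\<lambda>x. f x * cos (real k * x))"
    by (subst integral_add) (auto intro!: int ci)
  ultimately have "integral {0..2 * pi} (\<lambda>x. f' x * sin (real k * x))
      = - real k * integral {0..2 * pi} (\<lambda>x. f x * cos (real k * x))" by simp
  then show "fourier_sin f' k = - real k * fourier_cos f k"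
    by (simp add: fourier_cos_def fourier_sin_def)
qed

lemma fourier_coeff_bound:
  assumes cont: "continuous_on UNIV f" and M: "\<And>x. \<bar>f x\<bar> \<le> M"
  shows "\<bar>fourier_cos f k\<bar> \<le> 2 * M" "\<bar>fourier_sin f k\<bar> \<le> 2 * M"
proof -
  have c: "continuous_on {0..2 * pi} f" using cont continuous_on_subset by blast
  have M0: "0 \<le> M" using M[of 0] by linarith
  have b: "\<bar>f t * w\<bar> \<le> M" if "\<bar>w\<bar> \<le> 1" for t w :: real
    using mult_mono[OF M that M0] by (simp add: abs_mult)
  have "norm (integral {0..2 * pi} (\<lambda>t. f t * cos (real k * t))) \<le> M * (2 * pi - 0)"
    by (rule integral_bound) (auto intro!: c continuous_intros b)
  moreover have "\<bar>if k = 0 then 1 / (2 * pi) else 1 / pi\<bar> \<le> 1 / pi" by (simp add: field_simps)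
  ultimately have "\<bar>fourier_cos f k\<bar> \<le> 1 / pi * (M * (2 * pi))"
    unfolding fourier_cos_def abs_mult by (intro mult_mono) auto
  then show "\<bar>fourier_cos f k\<bar> \<le> 2 * M" by simp
  have "norm (integral {0..2 * pi} (\<lambda>t. f t * sin (real k * t))) \<le> M * (2 * pi - 0)"
    by (rule integral_bound) (auto intro!: c continuous_intros b)
  then show "\<bar>fourier_sin f k\<bar> \<le> 2 * M"
    by (simp add: fourier_sin_def abs_mult field_simps)
qed

text \<open>Each derivative gains a factor \<open>k\<close>. The bounds are kept in product form so that \<open>k = 0\<close> needs no
  separate treatment.\<close>
lemma fourier_coeff_decay:
  assumes "periodic_fun_simple f (2 * pi)" "times_cont_diff m f" "\<And>x. \<bar>(deriv ^^ m) f x\<bar> \<le> M"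
  shows "real k ^ m * \<bar>fourier_cos f k\<bar> \<le> 2 * M" "real k ^ m * \<bar>fourier_sin f k\<bar> \<le> 2 * M"
proof -
  have "real k ^ m * \<bar>fourier_cos f k\<bar> \<le> 2 * M \<and> real k ^ m * \<bar>fourier_sin f k\<bar> \<le> 2 * M"
    using assms
  proof (induction m arbitrary: f)
    case 0
    then show ?case using fourier_coeff_bound[OF times_cont_diff_continuous[OF 0(2)]] by simp
  next
    case (Suc m)
    have d: "f differentiable_on UNIV" "times_cont_diff m (deriv f)"
      using Suc.prems(2) by (simp_all add: times_cont_diff_Suc)
    have IH: "real k ^ m * \<bar>fourier_cos (deriv f) k\<bar> \<le> 2 * M" "real k ^ m * \<bar>fourier_sin (deriv f) k\<bar> \<le> 2 * M"
      using Suc.IH[OF periodic_deriv[OF Suc.prems(1)] d(2)] Suc.prems(3) by (simp_all add: funpow_swap1)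
    note c = fourier_coeff_deriv[OF periodic_end[OF Suc.prems(1)] times_cont_diff_DERIV[OF Suc.prems(2)]
      times_cont_diff_continuous[OF d(2)]]
    show ?case using IH unfolding c by (simp add: abs_mult mult_ac)
  qed
  then show "real k ^ m * \<bar>fourier_cos f k\<bar> \<le> 2 * M" "real k ^ m * \<bar>fourier_sin f k\<bar> \<le> 2 * M" by auto
qed

text \<open>Differentiation commutes with truncation, so the error of the derivative is itself a truncation
  error and no series has to be differentiated term by term.\<close>
lemma deriv_fourier_sum:
  assumes "periodic_fun_simple f (2 * pi)" "times_cont_diff 1 f"
  shows "deriv (fourier_sum f n) x = fourier_sum (deriv f) n x"
proof -
  have d: "times_cont_diff 0 (deriv f)" using assms(2) times_cont_diff_Suc[of 0] by simp
  note c = fourier_coeff_deriv[OF periodic_end[OF assms(1)] times_cont_diff_DERIV[of 0]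
      times_cont_diff_continuous[OF d]]
  have "fourier_cos (deriv f) = (\<lambda>k. real k * fourier_sin f k)"
       "fourier_sin (deriv f) = (\<lambda>k. - real k * fourier_cos f k)"
    using c assms(2) by auto
  then show ?thesis by (simp add: DERIV_imp_deriv[OF trig_sum_has_derivative])
qed

section \<open>Uniqueness and convergence of Fourier series\<close>

text \<open>A function with vanishing Fourier coefficients is orthogonal to all powers of \<open>s + cos (t - a)\<close>. The
  induction on the exponent needs the extra factor \<open>cos (k (t - a))\<close>, for all integers \<open>k\<close> at once: one
  more power of the kernel shifts \<open>k\<close> by \<open>\<plusminus>1\<close>.\<close>
lemma integral_peak_kernel_zero:
  fixes h :: "real \<Rightarrow> real" and a s :: real
  assumes cont: "continuous_on {0..2 * pi} h"
    and zero: "\<And>k::nat. integral {0..2 * pi} (\<lambda>t. h t * cos (real k * t)) = 0"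
              "\<And>k::nat. integral {0..2 * pi} (\<lambda>t. h t * sin (real k * t)) = 0"
  shows "integral {0..2 * pi} (\<lambda>t. h t * (s + cos (t - a)) ^ n) = 0"
proof -
  have int: "(\<lambda>t. h t * w t) integrable_on {0..2 * pi}" if "continuous_on {0..2 * pi} w" for w
    by (intro integrable_continuous_real continuous_on_mult cont that)
  have "integral {0..2 * pi} (\<lambda>t. h t * ((s + cos (t - a)) ^ n * cos (of_int k * (t - a)))) = 0" for k :: int
  proof (induction n arbitrary: k)
    case 0
    have "\<exists>c d. \<forall>t. cos (of_int k * (t - a)) = c * cos (real (nat \<bar>k\<bar>) * t) + d * sin (real (nat \<bar>k\<bar>) * t)"
    proof (intro exI allI)
      fix t :: real
      have "cos (of_int k * (t - a)) = cos (real (nat \<bar>k\<bar>) * t - real (nat \<bar>k\<bar>) * a)"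
        by (cases "k \<ge> 0") (auto simp: algebra_simps cos_diff)
      then show "cos (of_int k * (t - a)) = cos (real (nat \<bar>k\<bar>) * a) * cos (real (nat \<bar>k\<bar>) * t)
          + sin (real (nat \<bar>k\<bar>) * a) * sin (real (nat \<bar>k\<bar>) * t)"
        by (simp add: cos_diff)
    qed
    then obtain c d where cd: "\<And>t. cos (of_int k * (t - a)) = c * cos (real (nat \<bar>k\<bar>) * t) + d * sin (real (nat \<bar>k\<bar>) * t)"
      by blast
    have "integral {0..2 * pi} (\<lambda>t. c * (h t * cos (real (nat \<bar>k\<bar>) * t)) + d * (h t * sin (real (nat \<bar>k\<bar>) * t)))
       = c * integral {0..2 * pi} (\<lambda>t. h t * cos (real (nat \<bar>k\<bar>) * t)) + d * integral {0..2 * pi} (\<lambda>t. h t * sin (real (nat \<bar>k\<bar>) * t))"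
      by (subst integral_add) (auto intro!: integrable_on_mult_right int continuous_intros)
    then have "integral {0..2 * pi} (\<lambda>t. c * (h t * cos (real (nat \<bar>k\<bar>) * t)) + d * (h t * sin (real (nat \<bar>k\<bar>) * t))) = 0"
      by (simp only: zero)
    then show ?case unfolding cd by (simp add: algebra_simps)
  next
    case (Suc n)
    define W where "W k t = (s + cos (t - a)) ^ n * cos (of_int k * (t - a))" for k :: int and t
    have W: "continuous_on {0..2 * pi} (W k)" for k unfolding W_def by (intro continuous_intros)
    have step: "h t * ((s + cos (t - a)) ^ Suc n * cos (of_int k * (t - a)))
      = s * (h t * W k t) + (1/2) * (h t * W (k + 1) t) + (1/2) * (h t * W (k - 1) t)" for t
    proof -
      have "of_int (k + 1) * (t - a) = of_int k * (t - a) + (t - a)" "of_int (k - 1) * (t - a) = of_int k * (t - a) - (t - a)"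
        by (simp_all add: algebra_simps)
      then show ?thesis unfolding W_def by (simp only: cos_add cos_diff) (simp add: algebra_simps)
    qed
    have "integral {0..2 * pi} (\<lambda>t. s * (h t * W k t) + (1/2) * (h t * W (k + 1) t) + (1/2) * (h t * W (k - 1) t))
      = s * integral {0..2 * pi} (\<lambda>t. h t * W k t) + (1/2) * integral {0..2 * pi} (\<lambda>t. h t * W (k + 1) t)
        + (1/2) * integral {0..2 * pi} (\<lambda>t. h t * W (k - 1) t)"
      by (subst integral_add integral_mult_right | intro integrable_add integrable_on_mult_right int W)+ simp
    then show ?case unfolding step W_def Suc.IH by simp
  qed
  from this[of 0] show ?thesis by simp
qed

text \<open>If \<open>h a > 0\<close>, integrate \<open>h\<close> against \<open>Q\<^sup>n\<close> with \<open>Q t = 1 - cos \<delta> + cos (t - a)\<close>. This kernel exceeds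
  \<open>1\<close> near \<open>a\<close>, where \<open>h\<close> is positive, and has modulus at most \<open>1\<close> elsewhere, so the integral tends to
  infinity; but it is zero for every \<open>n\<close>.\<close>
lemma fourier_peak_nonpos:
  fixes h :: "real \<Rightarrow> real"
  assumes cont: "continuous_on {0..2 * pi} h"
    and zero: "\<And>k::nat. integral {0..2 * pi} (\<lambda>t. h t * cos (real k * t)) = 0"
              "\<And>k::nat. integral {0..2 * pi} (\<lambda>t. h t * sin (real k * t)) = 0"
    and a: "0 < a" "a < 2 * pi"
  shows "h a \<le> 0"
proof (rule ccontr)
  assume "\<not> h a \<le> 0"
  define c0 where "c0 = h a / 2"
  have c0: "0 < c0" using \<open>\<not> h a \<le> 0\<close> by (simp add: c0_def)
  obtain e where e: "e > 0" "\<And>t. t \<in> {0..2 * pi} \<Longrightarrow> dist t a < e \<Longrightarrow> dist (h t) (h a) < c0"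
    using cont a c0 unfolding continuous_on_iff by (metis atLeastAtMost_iff less_imp_le)
  \<comment> \<open>The bounds by \<open>a\<close> and \<open>2 \<pi> - a\<close> keep \<open>t - a\<close> away from \<open>\<plusminus>2 \<pi>\<close>, where the kernel would
    peak again; the bound by \<open>\<pi> / 2\<close> makes \<open>cos \<delta>\<close> nonnegative, hence \<open>Q \<ge> - 1\<close>.\<close>
  define \<delta> where "\<delta> = min (e / 2) (min (pi / 2) (min a (2 * pi - a)))"
  have \<delta>: "0 < \<delta>" "\<delta> < e" "\<delta> \<le> pi / 2" "\<delta> \<le> a" "\<delta> \<le> 2 * pi - a"
  proof -
    have "\<delta> \<le> e / 2" "\<delta> \<le> pi / 2" "\<delta> \<le> a" "\<delta> \<le> 2 * pi - a"
      by (simp_all only: \<delta>_def min_le_iff_disj order.refl simp_thms)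
    moreover have "0 < \<delta>" using e(1) a by (simp add: \<delta>_def)
    ultimately show "0 < \<delta>" "\<delta> < e" "\<delta> \<le> pi / 2" "\<delta> \<le> a" "\<delta> \<le> 2 * pi - a"
      using e(1) by linarith+
  qed
  have near: "c0 \<le> h t" if "\<bar>t - a\<bar> \<le> \<delta>" for t
  proof -
    have "t \<in> {0..2 * pi}" "dist t a < e" using that \<delta> by (auto simp: dist_real_def)
    then have "dist (h t) (h a) < c0" by (rule e(2))
    then show ?thesis unfolding dist_real_def c0_def by linarith
  qed
  define Q where "Q t = (1 - cos \<delta>) + cos (t - a)" for t
  define q where "q = 1 - cos \<delta> + cos (\<delta> / 2)"
  have q: "q > 1" using \<delta> cos_monotone_0_pi[of "\<delta> / 2" \<delta>] by (simp add: q_def)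
  have Q1: "1 \<le> Q t" if "\<bar>t - a\<bar> \<le> \<delta>" for t
    using that \<delta> cos_monotone_0_pi_le[of "\<bar>t - a\<bar>" \<delta>] by (simp add: Q_def)
  have Qq: "q \<le> Q t" if "\<bar>t - a\<bar> \<le> \<delta> / 2" for t
    using that \<delta> cos_monotone_0_pi_le[of "\<bar>t - a\<bar>" "\<delta> / 2"] by (simp add: Q_def q_def)
  have Qfar: "\<bar>Q t\<bar> \<le> 1" if "\<delta> < \<bar>t - a\<bar>" "t \<in> {0..2 * pi}" for t
  proof -
    have "cos (t - a) \<le> cos \<delta>"
    proof (cases "\<bar>t - a\<bar> \<le> pi")
      case True
      then show ?thesis using that \<delta> cos_monotone_0_pi_le[of \<delta> "\<bar>t - a\<bar>"] by simp
    next
      case False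
      have "cos (2 * pi - \<bar>t - a\<bar>) \<le> cos \<delta>"
        using False that \<delta> a by (intro cos_monotone_0_pi_le) auto
      then show ?thesis by (simp add: cos_diff)
    qed
    moreover have "0 \<le> cos \<delta>" using \<delta> by (intro cos_ge_zero) auto
    moreover have "- 1 \<le> cos (t - a)" "cos \<delta> \<le> 1" by simp_all
    ultimately show ?thesis unfolding Q_def by linarith
  qed
  have "bounded (h ` {0..2 * pi})"
    by (intro compact_imp_bounded compact_continuous_image cont compact_Icc)
  then obtain B where B: "B > 0" "\<And>t. t \<in> {0..2 * pi} \<Longrightarrow> \<bar>h t\<bar> \<le> B"
    unfolding bounded_pos by auto
  have bound: "c0 * q ^ n * \<delta> \<le> 2 * pi * B" for n
  proof -
    have mem: "t \<in> {a - \<delta> / 2..a + \<delta> / 2} \<longleftrightarrow> \<bar>t - a\<bar> \<le> \<delta> / 2" for t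
      by (simp only: atLeastAtMost_iff abs_diff_le_iff)
    have sub: "{a - \<delta> / 2..a + \<delta> / 2} \<subseteq> {0..2 * pi}" using \<delta> a by auto
    have "((\<lambda>t. if t \<in> {a - \<delta> / 2..a + \<delta> / 2} then c0 * q ^ n else 0) has_integral
        c0 * q ^ n * ((a + \<delta> / 2) - (a - \<delta> / 2))) {0..2 * pi}"
      unfolding has_integral_restrict[OF sub]
      using has_integral_const_real[of "c0 * q ^ n" "a - \<delta> / 2" "a + \<delta> / 2"] \<delta>(1) by (simp add: mult_ac)
    then have lower: "((\<lambda>t. (if t \<in> {a - \<delta> / 2..a + \<delta> / 2} then c0 * q ^ n else 0) - B) has_integral
        c0 * q ^ n * ((a + \<delta> / 2) - (a - \<delta> / 2)) - 2 * pi * B) {0..2 * pi}"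
      using has_integral_const_real[of B 0 "2 * pi"] by (intro has_integral_diff) simp_all
    have "((\<lambda>t. h t * Q t ^ n) has_integral integral {0..2 * pi} (\<lambda>t. h t * Q t ^ n)) {0..2 * pi}"
      unfolding Q_def by (intro integrable_integral integrable_continuous_real continuous_intros cont)
    also have "integral {0..2 * pi} (\<lambda>t. h t * Q t ^ n) = 0"
      unfolding Q_def by (rule integral_peak_kernel_zero[OF cont zero])
    finally have upper: "((\<lambda>t. h t * Q t ^ n) has_integral 0) {0..2 * pi}" .
    have "c0 * q ^ n * ((a + \<delta> / 2) - (a - \<delta> / 2)) - 2 * pi * B \<le> 0"
    proof (rule has_integral_le[OF lower upper])
      fix t assume t: "t \<in> {0..2 * pi}"
      consider "\<bar>t - a\<bar> \<le> \<delta> / 2" | "\<delta> / 2 < \<bar>t - a\<bar>" "\<bar>t - a\<bar> \<le> \<delta>" | "\<delta> < \<bar>t - a\<bar>" by linarith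
      then show "(if t \<in> {a - \<delta> / 2..a + \<delta> / 2} then c0 * q ^ n else 0) - B \<le> h t * Q t ^ n"
      proof cases
        case 1
        have "c0 * q ^ n \<le> h t * Q t ^ n"
          using 1 near[of t] Qq[OF 1] q c0 \<delta> by (intro mult_mono power_mono) auto
        moreover have "t \<in> {a - \<delta> / 2..a + \<delta> / 2}" using 1 by (simp only: mem)
        ultimately show ?thesis using B(1) by simp
      next
        case 2
        have "0 \<le> h t * Q t ^ n" using near[OF 2(2)] Q1[OF 2(2)] c0 by (intro mult_nonneg_nonneg) auto
        moreover have far: "t \<notin> {a - \<delta> / 2..a + \<delta> / 2}" using 2(1) unfolding mem by simp
        ultimately show ?thesis unfolding if_not_P[OF far] using B(1) by linarith
      next
        case 3
        have "\<bar>h t * Q t ^ n\<bar> \<le> B * 1"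
          unfolding abs_mult power_abs using B t Qfar[OF 3 t] by (intro mult_mono power_le_one) auto
        moreover have far: "t \<notin> {a - \<delta> / 2..a + \<delta> / 2}" using 3 \<delta>(1) unfolding mem by simp
        ultimately show ?thesis unfolding if_not_P[OF far] by linarith
      qed
    qed
    then show ?thesis by simp
  qed
  obtain n where "2 * pi * B / (c0 * \<delta>) < q ^ n" using real_arch_pow[OF q] by blast
  then show False using bound[of n] c0 \<delta>(1) by (simp add: field_simps)
qed

text \<open>The peak argument applies to \<open>h\<close> and to \<open>- h\<close> at interior points; the end points follow by continuity.\<close>
lemma fourier_uniqueness:
  fixes h :: "real \<Rightarrow> real"
  assumes cont: "continuous_on {0..2 * pi} h"
    and zero: "\<And>k::nat. integral {0..2 * pi} (\<lambda>t. h t * cos (real k * t)) = 0"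
              "\<And>k::nat. integral {0..2 * pi} (\<lambda>t. h t * sin (real k * t)) = 0"
    and x: "x \<in> {0..2 * pi}"
  shows "h x = 0"
proof -
  have "h a = 0" if "a \<in> {0<..<2 * pi}" for a
  proof (rule antisym)
    show "h a \<le> 0" using fourier_peak_nonpos[OF cont zero] that by simp
    have "- h a \<le> 0"
      using fourier_peak_nonpos[of "\<lambda>t. - h t" a] that zero cont by (simp add: continuous_on_minus)
    then show "0 \<le> h a" by simp
  qed
  moreover have "closure {0<..<2 * pi} = {0..2 * pi}" by (simp add: closure_greaterThanLessThan)
  ultimately show ?thesis
    using continuous_constant_on_closure[of "{0<..<2 * pi}" h 0 x] cont x by auto
qed

text \<open>The series converges uniformly by the Weierstrass test. Its sum \<open>g\<close> is continuous and has the same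
  Fourier coefficients as \<open>f\<close>, because integration commutes with uniform limits; uniqueness gives
  \<open>g = f\<close>.\<close>
lemma fourier_series_sums:
  assumes per: "periodic_fun_simple f (2 * pi)" and cont: "continuous_on UNIV f"
    and decay: "\<And>k. k > 0 \<Longrightarrow> \<bar>fourier_cos f k\<bar> \<le> C / real k ^ 2"
               "\<And>k. k > 0 \<Longrightarrow> \<bar>fourier_sin f k\<bar> \<le> C / real k ^ 2"
  shows "(\<lambda>k. fourier_cos f k * cos (real k * x) + fourier_sin f k * sin (real k * x)) sums f x"
proof -
  interpret periodic_fun_simple f "2 * pi" by (rule per)
  define u where "u k x = fourier_cos f k * cos (real k * x) + fourier_sin f k * sin (real k * x)" for k x
  define g where "g x = (\<Sum>k. u k x)" for x
  define B where "B k = (if k = 0 then \<bar>fourier_cos f 0\<bar> else 2 * C * (1 / real k ^ 2))" for k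
  have u_bound: "\<bar>u k x\<bar> \<le> B k" for k x
  proof (cases "k = 0")
    case False
    have "\<bar>u k x\<bar> \<le> \<bar>fourier_cos f k\<bar> * \<bar>cos (real k * x)\<bar> + \<bar>fourier_sin f k\<bar> * \<bar>sin (real k * x)\<bar>"
      unfolding u_def abs_mult[symmetric] by (rule abs_triangle_ineq)
    also have "\<dots> \<le> \<bar>fourier_cos f k\<bar> * 1 + \<bar>fourier_sin f k\<bar> * 1"
      by (intro add_mono mult_left_mono) auto
    also have "\<dots> \<le> B k" using decay[of k] False by (simp add: B_def)
    finally show ?thesis .
  qed (simp add: u_def B_def)
  have B: "summable B"
  proof -
    have "summable (\<lambda>k. 2 * C * (1 / real (k + 1) ^ 2))"
      using inverse_squares_sums by (intro summable_mult) (simp add: sums_iff add.commute)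
    then have "summable (\<lambda>k. B (k + 1))" by (simp add: B_def)
    then show ?thesis by (subst (asm) summable_iff_shift)
  qed
  \<comment> \<open>The two indexings of partial sums differ by one: \<open>{..<n}\<close> here, \<open>{..n}\<close> in \<^const>\<open>trig_sum\<close>.\<close>
  have ut: "(\<Sum>k<n. u k x) = trig_sum (fourier_cos f) (fourier_sin f) (n - 1) x" if "n > 0" for n x
  proof -
    have "{..<n} = {..n - 1}" using that by auto
    then show ?thesis by (simp add: u_def trig_sum_def)
  qed
  have weighted: "uniform_limit UNIV (\<lambda>n x. \<Sum>k<n. u k x * w x) (\<lambda>x. g x * w x) sequentially"
    if w: "\<And>x. \<bar>w x\<bar> \<le> 1" for w :: "real \<Rightarrow> real"
  proof -
    have "uniform_limit UNIV (\<lambda>n x. \<Sum>k<n. u k x * w x) (\<lambda>x. \<Sum>k. u k x * w x) sequentially"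
    proof (rule Weierstrass_m_test[OF _ B])
      fix k x show "norm (u k x * w x) \<le> B k"
        using mult_mono[OF u_bound w] u_bound[of k x] by (simp add: abs_mult)
    qed
    moreover have "(\<Sum>k. u k x * w x) = g x * w x" for x
      unfolding g_def by (rule suminf_mult2[symmetric], rule summable_comparison_test'[OF B]) (use u_bound in auto)
    ultimately show ?thesis by simp
  qed
  have cu: "continuous_on S (\<lambda>x. \<Sum>k<n. u k x)" for S n
    unfolding u_def by (intro continuous_intros)
  have cg: "continuous_on UNIV g"
  proof (rule uniform_limit_theorem)
    show "uniform_limit UNIV (\<lambda>n x. \<Sum>k<n. u k x) g sequentially" using weighted[of "\<lambda>_. 1"] by simp
  qed (simp_all add: cu)
  have cont': "continuous_on S f" "continuous_on S g" for S
    using cont cg continuous_on_subset by blast+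
  have limit: "integral {0..2 * pi} (\<lambda>x. g x * w x) = I"
    if w: "\<And>x. \<bar>w x\<bar> \<le> 1" "continuous_on UNIV w"
      and ev: "\<And>n. n > K \<Longrightarrow> integral {0..2 * pi} (\<lambda>x. (\<Sum>k<n. u k x) * w x) = I" for w I and K :: nat
  proof -
    have wc: "continuous_on {0..2 * pi} w" using w(2) continuous_on_subset by blast
    obtain J L where J: "\<And>n. ((\<lambda>x. \<Sum>k<n. u k x * w x) has_integral J n) {0..2 * pi}"
      "((\<lambda>x. g x * w x) has_integral L) {0..2 * pi}" "J \<longlonglongrightarrow> L"
    proof (rule uniform_limit_integral[where a = 0 and b = "2 * pi" and F = sequentially
            and f = "\<lambda>n x. \<Sum>k<n. u k x * w x" and g = "\<lambda>x. g x * w x"])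
      show "uniform_limit {0..2 * pi} (\<lambda>n x. \<Sum>k<n. u k x * w x) (\<lambda>x. g x * w x) sequentially"
        using weighted[OF w(1)] by (rule uniform_limit_on_subset) simp
      show "continuous_on {0..2 * pi} (\<lambda>x. \<Sum>k<n. u k x * w x)" for n
        unfolding u_def by (intro continuous_intros wc)
    qed auto
    have "J n = I" if "n > K" for n
      using ev[OF that] J(1)[of n] by (simp add: integral_unique sum_distrib_right)
    then have "J \<longlonglongrightarrow> I" by (intro tendsto_eventually eventually_mono[OF eventually_gt_at_top[of K]])
    then show ?thesis using J(2,3) LIMSEQ_unique integral_unique by blast
  qed
  have gc: "integral {0..2 * pi} (\<lambda>x. g x * cos (real k * x)) = integral {0..2 * pi} (\<lambda>x. f x * cos (real k * x))" for k
  proof (rule limit[of _ k])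
    fix n assume n: "k < n"
    have "fourier_cos (fourier_sum f (n - 1)) k = fourier_cos f k"
      using n by (intro fourier_cos_trig_sum) simp
    then show "integral {0..2 * pi} (\<lambda>x. (\<Sum>k<n. u k x) * cos (real k * x)) = integral {0..2 * pi} (\<lambda>x. f x * cos (real k * x))"
      using n by (simp only: fourier_coeff_eq_iff) (simp add: ut)
  qed (auto intro!: continuous_intros)
  have gs: "integral {0..2 * pi} (\<lambda>x. g x * sin (real k * x)) = integral {0..2 * pi} (\<lambda>x. f x * sin (real k * x))" for k
  proof (cases "k = 0")
    case False
    show ?thesis
    proof (rule limit[of _ k])
      fix n assume n: "k < n"
      have "fourier_sin (fourier_sum f (n - 1)) k = fourier_sin f k"
        using n False by (intro fourier_sin_trig_sum) simp_all
      then show "integral {0..2 * pi} (\<lambda>x. (\<Sum>k<n. u k x) * sin (real k * x)) = integral {0..2 * pi} (\<lambda>x. f x * sin (real k * x))"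
        using n by (simp only: fourier_coeff_eq_iff) (simp add: ut)
    qed (auto intro!: continuous_intros)
  qed simp
  have base: "g x = f x" if "x \<in> {0..2 * pi}" for x
  proof -
    have "g x - f x = 0"
    proof (rule fourier_uniqueness[of "\<lambda>x. g x - f x", OF _ _ _ that])
      show "continuous_on {0..2 * pi} (\<lambda>x. g x - f x)" by (intro continuous_intros cont')
      fix k :: nat
      have "integral {0..2 * pi} (\<lambda>t. g t * w t - f t * w t) = integral {0..2 * pi} (\<lambda>t. g t * w t) - integral {0..2 * pi} (\<lambda>t. f t * w t)"
        if "continuous_on {0..2 * pi} w" for w
        by (intro integral_diff integrable_continuous_real continuous_on_mult cont' that)
      then show "integral {0..2 * pi} (\<lambda>t. (g t - f t) * cos (real k * t)) = 0"
        "integral {0..2 * pi} (\<lambda>t. (g t - f t) * sin (real k * t)) = 0"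
        by (simp_all add: left_diff_distrib gc gs continuous_intros)
    qed
    then show ?thesis by simp
  qed
  obtain y m where y: "y \<in> {0..2 * pi}" "x = y + of_int m * (2 * pi)" by (rule period_reduction)
  have "u k x = u k y" for k
  proof -
    have "real k * x = real k * y + of_int (int k * m) * (2 * pi)" using y(2) by (simp add: algebra_simps)
    then show ?thesis unfolding u_def using cos.plus_of_int[of "real k * y" "int k * m"] sin.plus_of_int[of "real k * y" "int k * m"]
      by simp
  qed
  then have "g x = g y" by (simp add: g_def)
  also have "\<dots> = f y" by (rule base[OF y(1)])
  also have "\<dots> = f x" by (simp add: y(2) plus_of_int)
  finally have "g x = f x" .
  moreover have "summable (\<lambda>k. u k x)" by (rule summable_comparison_test'[OF B]) (use u_bound in auto)
  ultimately show ?thesis unfolding g_def u_def by (simp add: sums_iff)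
qed

text \<open>Two of the \<open>p + 2\<close> powers of \<open>1 / k\<close> make the tail summable, with sum at most \<open>\<pi>\<^sup>2 / 6\<close>; the
  remaining \<open>p\<close> are bounded by their value at the first omitted frequency \<open>n + 1\<close>.\<close>
lemma fourier_truncation_error:
  assumes per: "periodic_fun_simple f (2 * pi)" and diff: "times_cont_diff (p + 2) f"
    and M: "\<And>x. \<bar>(deriv ^^ (p + 2)) f x\<bar> \<le> M"
  shows "\<bar>f x - fourier_sum f n x\<bar> \<le> 4 * M * (pi\<^sup>2 / 6) / (real n + 1) ^ p"
proof -
  define u where "u k = fourier_cos f k * cos (real k * x) + fourier_sin f k * sin (real k * x)" for k
  have M0: "0 \<le> M" using M[of 0] by linarith
  note decay = fourier_coeff_decay[OF per diff M]
  have d: "\<bar>fourier_cos f k\<bar> \<le> 2 * M / real k ^ (p + 2)" "\<bar>fourier_sin f k\<bar> \<le> 2 * M / real k ^ (p + 2)" if "k > 0" for k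
    using decay[of k] that by (simp_all add: field_simps)
  have d2: "2 * M / real k ^ (p + 2) \<le> 2 * M / real k ^ 2" if "k > 0" for k
    using that M0 by (intro divide_left_mono power_increasing) auto
  have s: "u sums f x" unfolding u_def
    by (rule fourier_series_sums[OF per times_cont_diff_continuous[OF diff]])
      (use d d2 order_trans in blast)+
  have "(\<lambda>i. u (i + (n + 1))) sums (f x - (\<Sum>k<n + 1. u k))" by (rule sums_split_initial_segment[OF s])
  moreover have "(\<Sum>k<n + 1. u k) = fourier_sum f n x" by (simp add: trig_sum_def u_def lessThan_Suc_atMost)
  ultimately have tail: "(\<lambda>i. u (i + (n + 1))) sums (f x - fourier_sum f n x)" by simp
  define c where "c = 4 * M / (real n + 1) ^ p"
  have g: "(\<lambda>i. c * (1 / (real i + 1)\<^sup>2)) sums (c * (pi\<^sup>2 / 6))"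
    by (rule sums_mult) (use inverse_squares_sums in \<open>simp add: add.commute\<close>)
  have le: "\<bar>u (i + (n + 1))\<bar> \<le> c * (1 / (real i + 1)\<^sup>2)" for i
  proof -
    define k where "k = i + (n + 1)"
    have k: "k > 0" by (simp add: k_def)
    have "\<bar>u k\<bar> \<le> \<bar>fourier_cos f k\<bar> * \<bar>cos (real k * x)\<bar> + \<bar>fourier_sin f k\<bar> * \<bar>sin (real k * x)\<bar>"
      unfolding u_def abs_mult[symmetric] by (rule abs_triangle_ineq)
    also have "\<dots> \<le> \<bar>fourier_cos f k\<bar> * 1 + \<bar>fourier_sin f k\<bar> * 1"
      by (intro add_mono mult_left_mono) auto
    also have "\<dots> \<le> 2 * M / real k ^ (p + 2) + 2 * M / real k ^ (p + 2)"
      unfolding mult_1_right by (rule add_mono[OF d[OF k]])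
    also have "\<dots> = 4 * M / real k ^ (p + 2)" by (simp only: add_divide_distrib[symmetric]) simp
    also have "\<dots> \<le> 4 * M / ((real n + 1) ^ p * (real i + 1)\<^sup>2)"
      unfolding power_add using M0 k
      by (intro divide_left_mono mult_mono power_mono mult_pos_pos zero_less_power) (auto simp: k_def)
    also have "\<dots> = c * (1 / (real i + 1)\<^sup>2)" by (simp add: c_def)
    finally show ?thesis by (simp only: k_def)
  qed
  have "norm (\<Sum>i. u (i + (n + 1))) \<le> (\<Sum>i. c * (1 / (real i + 1)\<^sup>2))"
    by (rule norm_suminf_le) (use le sums_summable[OF g] in auto)
  then show ?thesis using sums_unique[OF tail] sums_unique[OF g] by (simp add: c_def)
qed

section \<open>The error for functions of finite smoothness\<close>

lemma E_err_le:
  assumes "N > 0" "\<And>j. \<bar>deriv f (node N j) - D1_multilevel N f j\<bar> \<le> b"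
  shows "E_err f N \<le> b"
  unfolding E_err_def using assms by (subst Max_le_iff) auto

lemma E_err_nonneg:
  assumes "N > 0"
  shows "0 \<le> E_err f N"
proof -
  have "\<bar>deriv f (node N 0) - D1_multilevel N f 0\<bar> \<le> E_err f N"
    unfolding E_err_def using assms by (intro Max_ge) auto
  then show ?thesis by linarith
qed

lemma E_err_trig_sum:
  assumes N: "N = 4 * M" "M > 0" and n: "n < 2 * M"
  shows "E_err (trig_sum a b n) N = 0"
  using E_err_le[of N "trig_sum a b n" 0] E_err_nonneg[of N "trig_sum a b n"] D1_multilevel_trig_sum[OF N n] N by force

text \<open>The central estimate. Here \<open>f - T\<close> gains one power of \<open>N / 2 = 2 K\<close> over \<open>f' - T'\<close>, but stability
  costs two, so one positive power remains. The dependence on the derivative bound \<open>M\<close> is explicit and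
  the constant does not depend on \<open>q\<close>; both are essential when \<open>q\<close> grows with \<open>N\<close>.\<close>
lemma E_err_smooth:
  assumes N: "N = 4 * K" "K > 0" and per: "periodic_fun_simple f (2 * pi)"
    and diff: "times_cont_diff (q + 3) f" and M: "\<And>x. \<bar>(deriv ^^ (q + 3)) f x\<bar> \<le> M"
  shows "E_err f N \<le> 4 * pi\<^sup>2 / 3 * M * (2 * real K) / (2 * real K) ^ q"
proof (rule E_err_le)
  show "N > 0" using N by simp
  fix j
  \<comment> \<open>the largest degree that is differentiated exactly\<close>
  define n where "n = 2 * K - 1"
  have n1: "real n + 1 = 2 * real K" using N by (simp add: n_def of_nat_diff)
  define T where "T = fourier_sum f n"
  have M0: "0 \<le> M" using M[of 0] by linarith
  have d1: "times_cont_diff 1 f" using times_cont_diff_antimono[OF diff, of 1] by simp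
  have fT: "\<bar>f x - T x\<bar> \<le> 4 * M * (pi\<^sup>2 / 6) / (2 * real K) ^ (q + 1)" for x
    using fourier_truncation_error[OF per, of "q + 1" M x n] diff M unfolding T_def n1 by (simp add: numeral_3_eq_3)
  have dT: "\<bar>deriv f x - deriv T x\<bar> \<le> 4 * M * (pi\<^sup>2 / 6) / (2 * real K) ^ q" for x
  proof -
    have "times_cont_diff (q + 2) (deriv f)" using diff times_cont_diff_Suc[of "q + 2" f] by (simp add: numeral_3_eq_3)
    moreover have "\<bar>(deriv ^^ (q + 2)) (deriv f) x\<bar> \<le> M" for x
      using M[of x] by (simp add: numeral_3_eq_3 funpow_swap1)
    ultimately show ?thesis
      using fourier_truncation_error[OF periodic_deriv[OF per], of q M x n]
      unfolding T_def n1 deriv_fourier_sum[OF per d1] by simp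
  qed
  have exact: "D1_multilevel N T j = deriv T (node N j)"
    unfolding T_def by (rule D1_multilevel_trig_sum[OF N]) (use N in \<open>simp add: n_def\<close>)
  have "deriv f (node N j) - D1_multilevel N f j
     = (deriv f (node N j) - deriv T (node N j)) - D1_multilevel N (\<lambda>x. f x - T x) j"
    by (simp add: D1_multilevel_diff exact)
  also have "\<bar>\<dots>\<bar> \<le> 4 * M * (pi\<^sup>2 / 6) / (2 * real K) ^ q
        + (2 * real K)\<^sup>2 * (4 * M * (pi\<^sup>2 / 6) / (2 * real K) ^ (q + 1))"
    by (rule order_trans[OF abs_triangle_ineq4 add_mono[OF dT D1_multilevel_stable[OF N fT]]])
  also have "\<dots> = 4 * M * (pi\<^sup>2 / 6) * (1 + 2 * real K) / (2 * real K) ^ q"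
    using N by (simp add: field_simps power2_eq_square)
  also have "\<dots> \<le> 4 * M * (pi\<^sup>2 / 6) * (2 * (2 * real K)) / (2 * real K) ^ q"
    using N M0 by (intro divide_right_mono mult_left_mono) auto
  also have "\<dots> = 4 * pi\<^sup>2 / 3 * M * (2 * real K) / (2 * real K) ^ q" by simp
  finally show "\<bar>deriv f (node N j) - D1_multilevel N f j\<bar>
      \<le> 4 * pi\<^sup>2 / 3 * M * (2 * real K) / (2 * real K) ^ q" .
qed

text \<open>Stability alone, without approximation. It serves the functions that are too rough for the central
  estimate.\<close>
lemma E_err_crude:
  assumes N: "N = 4 * K" "K > 0" and f: "\<And>x. \<bar>f x\<bar> \<le> M0" and d: "\<And>x. \<bar>deriv f x\<bar> \<le> M1"
  shows "E_err f N \<le> (M1 + M0) * (2 * real K)\<^sup>2"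
proof (rule E_err_le)
  show "N > 0" using N by simp
  fix j
  have M: "0 \<le> M1" using d[of 0] by linarith
  have "\<bar>deriv f (node N j) - D1_multilevel N f j\<bar> \<le> M1 + (2 * real K)\<^sup>2 * M0"
    by (rule order_trans[OF abs_triangle_ineq4 add_mono[OF d D1_multilevel_stable[OF N f]]])
  also have "M1 \<le> M1 * (2 * real K)\<^sup>2"
  proof -
    have "1 \<le> (2 * real K)\<^sup>2" using N by (intro one_le_power) simp
    then show ?thesis using mult_left_mono[OF _ M, of 1 "(2 * real K)\<^sup>2"] by simp
  qed
  finally show "\<bar>deriv f (node N j) - D1_multilevel N f j\<bar> \<le> (M1 + M0) * (2 * real K)\<^sup>2"
    by (simp add: algebra_simps)
qed

text \<open>For \<open>m \<le> 2\<close> the exponent \<open>4 - m\<close> is at least \<open>2\<close>, so the crude bound already has the required order.\<close>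
lemma E_err_algebraic:
  assumes per: "periodic_fun_simple f (2 * pi)" and diff: "times_cont_diff m f" and m: "m \<ge> 1"
  obtains A where "A \<ge> 0" "\<And>K. K > 0 \<Longrightarrow> E_err f (4 * K) \<le> A * (2 * real K) powr (4 - real m)"
proof (cases "m \<ge> 3")
  case True
  then obtain q where q: "m = q + 3" by (metis le_add_diff_inverse2)
  obtain M where M: "M > 0" "\<And>x. \<bar>(deriv ^^ m) f x\<bar> \<le> M"
    using periodic_continuous_bounded[OF periodic_deriv_iterate[OF per] times_cont_diff_iterate[OF diff]] by blast
  show ?thesis
  proof (rule that[of "4 * pi\<^sup>2 / 3 * M"])
    show "0 \<le> 4 * pi\<^sup>2 / 3 * M" using M(1) by simp
    fix K :: nat assume K: "K > 0"
    have "x powr (1 - real q) = x / x ^ q" if "x > 0" for x :: real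
      using that by (simp add: powr_diff powr_realpow)
    then have "(2 * real K) powr (4 - real m) = (2 * real K) / (2 * real K) ^ q"
      using K by (simp add: q)
    then show "E_err f (4 * K) \<le> 4 * pi\<^sup>2 / 3 * M * (2 * real K) powr (4 - real m)"
      using E_err_smooth[OF refl K per diff[unfolded q] M(2)[unfolded q]] by simp
  qed
next
  case False
  have c: "times_cont_diff 0 f" "times_cont_diff 1 f" using times_cont_diff_antimono[OF diff] m by simp_all
  obtain M0 where M0: "M0 > 0" "\<And>x. \<bar>f x\<bar> \<le> M0"
    using periodic_continuous_bounded[OF per times_cont_diff_continuous[OF diff]] by blast
  obtain M1 where M1: "M1 > 0" "\<And>x. \<bar>deriv f x\<bar> \<le> M1"
    using periodic_continuous_bounded[OF periodic_deriv[OF per]] times_cont_diff_iterate[OF c(2)] by auto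
  show ?thesis
  proof (rule that[of "M1 + M0"])
    show "0 \<le> M1 + M0" using M0 M1 by simp
    fix K :: nat assume K: "K > 0"
    have "E_err f (4 * K) \<le> (M1 + M0) * (2 * real K)\<^sup>2"
      by (rule E_err_crude[OF refl K M0(2) M1(2)])
    also have "(2 * real K)\<^sup>2 = (2 * real K) powr 2" using K by simp
    also have "(M1 + M0) * (2 * real K) powr 2 \<le> (M1 + M0) * (2 * real K) powr (4 - real m)"
      using False K M0(1) M1(1) by (intro mult_left_mono powr_mono) auto
    finally show "E_err f (4 * K) \<le> (M1 + M0) * (2 * real K) powr (4 - real m)" .
  qed
qed

lemma E_err_bigo:
  assumes per: "periodic_fun_simple f (2 * pi)" and diff: "times_cont_diff m f" and m: "m \<ge> 1"
  shows "E_err f \<in> O[mult4_at_top](\<lambda>N. mesh N powr (real m - 4))"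
proof -
  obtain A where A: "A \<ge> 0" "\<And>K. K > 0 \<Longrightarrow> E_err f (4 * K) \<le> A * (2 * real K) powr (4 - real m)"
    using E_err_algebraic[OF assms] by blast
  have "norm (E_err f N) \<le> A * pi powr (4 - real m) * norm (mesh N powr (real m - 4))" if N: "N > 0" "4 dvd N" for N
  proof -
    obtain K where K: "N = 4 * K" "K > 0" using N by (auto elim!: dvdE)
    have "2 * real K = pi / mesh N" using K by (simp add: mesh_def)
    moreover have "mesh N > 0" using N by (simp add: mesh_def)
    ultimately have "(2 * real K) powr (4 - real m) = pi powr (4 - real m) * mesh N powr (real m - 4)"
      using powr_minus_divide[of "mesh N" "4 - real m"] by (simp add: powr_divide powr_minus_divide)
    then show ?thesis using A(2)[OF K(2)] E_err_nonneg[OF N(1), of f] K(1) by (simp add: mult_ac)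
  qed
  then show ?thesis
    unfolding mult4_at_top_def
    by (intro bigoI[of _ "A * pi powr (4 - real m)"])
      (auto simp: eventually_inf_principal intro!: eventually_mono[OF eventually_gt_at_top[of "0::nat"]])
qed

section \<open>Analytic functions\<close>

text \<open>Differentiability is carried through the induction together with the series, since \<^const>\<open>deriv\<close> is
  meaningful only for functions known to be differentiable.\<close>
lemma power_series_iterated_deriv:
  fixes f :: "real \<Rightarrow> real"
  assumes f: "\<And>x. \<bar>x - x0\<bar> < r \<Longrightarrow> (\<lambda>n. a n * (x - x0) ^ n) sums f x" and x: "\<bar>x - x0\<bar> < r"
  shows "(\<lambda>n. (diffs ^^ m) a n * (x - x0) ^ n) sums (deriv ^^ m) f x \<and>
    ((deriv ^^ m) f has_real_derivative (deriv ^^ Suc m) f x) (at x)"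
  using x
proof (induction m arbitrary: x)
  have deriv_step: "((deriv ^^ m) f has_real_derivative (\<Sum>n. diffs ((diffs ^^ m) a) n * (x - x0) ^ n)) (at x)"
    if s: "\<And>x. \<bar>x - x0\<bar> < r \<Longrightarrow> (\<lambda>n. (diffs ^^ m) a n * (x - x0) ^ n) sums (deriv ^^ m) f x"
      and x: "\<bar>x - x0\<bar> < r" for m x
  proof -
    let ?c = "(diffs ^^ m) a"
    have sm: "summable (\<lambda>n. ?c n * z ^ n)" if "norm z < r" for z
      using s[of "z + x0"] that by (auto simp: sums_iff)
    have "((\<lambda>z. \<Sum>n. ?c n * z ^ n) has_real_derivative (\<Sum>n. diffs ?c n * (x - x0) ^ n)) (at (x - x0))"
      by (rule termdiffs_strong'[OF sm]) (use x in simp_all)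
    then have "((\<lambda>y. \<Sum>n. ?c n * (y - x0) ^ n) has_real_derivative (\<Sum>n. diffs ?c n * (x - x0) ^ n)) (at x)"
      using DERIV_shift[of "\<lambda>y. \<Sum>n. ?c n * (y - x0) ^ n" _ "x - x0" x0] by simp
    moreover have "open {y. \<bar>y - x0\<bar> < r}" by (intro open_Collect_less continuous_intros)
    ultimately show ?thesis
      by (rule has_field_derivative_transform_within_open[where S = "{y. \<bar>y - x0\<bar> < r}"])
        (use s x in \<open>auto simp: sums_iff\<close>)
  qed
  {
    case 0
    then show ?case using f deriv_step[of 0 x] DERIV_imp_deriv[OF deriv_step[of 0 x]] by simp
  next
    case (Suc m)
    have IH: "(\<lambda>n. (diffs ^^ m) a n * (x - x0) ^ n) sums (deriv ^^ m) f x" if "\<bar>x - x0\<bar> < r" for x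
      using Suc.IH[OF that] by blast
    have next_sums: "(\<lambda>n. (diffs ^^ Suc m) a n * (x - x0) ^ n) sums (deriv ^^ Suc m) f x" if "\<bar>x - x0\<bar> < r" for x
    proof -
      have "summable (\<lambda>n. diffs ((diffs ^^ m) a) n * (x - x0) ^ n)"
      proof (rule termdiff_converges[where K = r])
        show "norm (x - x0) < r" using that by simp
        show "summable (\<lambda>n. (diffs ^^ m) a n * z ^ n)" if "norm z < r" for z
          using IH[of "z + x0"] that by (auto simp: sums_iff)
      qed
      then show ?thesis using DERIV_imp_deriv[OF deriv_step[OF IH that]] by (simp add: sums_iff)
    qed
    show ?case
      using next_sums[OF Suc.prems] deriv_step[of "Suc m" x, OF next_sums Suc.prems]
        DERIV_imp_deriv[OF deriv_step[of "Suc m" x, OF next_sums Suc.prems]] by simp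
  }
qed

lemma diffs_iterate: "(diffs ^^ m) a n = fact (n + m) / fact n * (a (n + m) :: real)"
proof (induction m arbitrary: n)
  case (Suc m)
  have "(diffs ^^ Suc m) a n = real (Suc n) * (diffs ^^ m) a (Suc n)"
    unfolding funpow.simps o_apply by (subst diffs_def) simp
  also have "\<dots> = real (Suc n) * (fact (n + Suc m) / fact (Suc n) * a (n + Suc m))"
    unfolding Suc.IH by simp
  also have "\<dots> = fact (n + Suc m) / fact n * a (n + Suc m)"
    unfolding fact_Suc[of n] by simp
  finally show ?case .
qed simp

text \<open>The coefficients satisfy \<open>\<bar>a\<^sub>n\<bar> \<le> B (2 / r)\<^sup>n\<close>. Differentiating \<open>m\<close> times multiplies the coefficient of
  index \<open>n + m\<close> by \<open>m!\<close> times a binomial coefficient, which is at most \<open>2\<^sup>n\<^sup>+\<^sup>m\<close>. The radius \<open>r / 8\<close> is small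
  enough to absorb this power and leave a geometric series of ratio \<open>1 / 2\<close>.\<close>
lemma power_series_deriv_bound:
  fixes f :: "real \<Rightarrow> real"
  assumes r: "r > 0" and f: "\<And>x. \<bar>x - x0\<bar> < r \<Longrightarrow> (\<lambda>n. a n * (x - x0) ^ n) sums f x"
  obtains C where "C > 0" "\<And>m x. \<bar>x - x0\<bar> < r / 8 \<Longrightarrow> \<bar>(deriv ^^ m) f x\<bar> \<le> C * fact m * (4 / r) ^ m"
proof -
  have "summable (\<lambda>n. a n * (r / 2) ^ n)" using f[of "x0 + r / 2"] r by (auto simp: sums_iff)
  then have "Bseq (\<lambda>n. a n * (r / 2) ^ n)"
    by (intro convergent_imp_Bseq convergentI[OF summable_LIMSEQ_zero])
  then obtain B where B: "B > 0" "\<And>n. \<bar>a n * (r / 2) ^ n\<bar> \<le> B" unfolding Bseq_def by auto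
  have a: "\<bar>a n\<bar> \<le> B * (2 / r) ^ n" for n
    using B(2)[of n] r by (simp add: abs_mult power_divide field_simps)
  show ?thesis
  proof (rule that[of "2 * B"])
    show "2 * B > 0" using B(1) by simp
    fix m :: nat and x :: real
    assume x: "\<bar>x - x0\<bar> < r / 8"
    define g where "g n = fact m * B * (4 / r) ^ m * (1 / 2) ^ n" for n
    have g: "g sums (fact m * B * (4 / r) ^ m * 2)"
      unfolding g_def using geometric_sums[of "1 / 2 :: real"] by (intro sums_mult) simp
    have le: "\<bar>(diffs ^^ m) a n * (x - x0) ^ n\<bar> \<le> g n" for n
    proof -
      have "fact (n + m) / fact n = fact m * real ((n + m) choose m)"
        by (simp add: binomial_fact)
      also have "\<dots> \<le> fact m * 2 ^ (n + m)"
        using of_nat_mono[OF binomial_le_pow2[of "n + m" m], where 'a = real] by (intro mult_left_mono) simp_all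
      finally have c: "fact (n + m) / fact n \<le> (fact m * 2 ^ (n + m) :: real)" .
      have "\<bar>(diffs ^^ m) a n * (x - x0) ^ n\<bar> = fact (n + m) / fact n * \<bar>a (n + m)\<bar> * \<bar>x - x0\<bar> ^ n"
        by (simp add: diffs_iterate abs_mult power_abs)
      also have "\<dots> \<le> fact m * 2 ^ (n + m) * (B * (2 / r) ^ (n + m)) * (r / 8) ^ n"
        using x r B(1) by (intro mult_mono power_mono c a) auto
      also have "\<dots> = fact m * B * (2 ^ (n + m) * (2 / r) ^ (n + m)) * (r / 8) ^ n"
        by (simp only: mult_ac)
      also have "2 ^ (n + m) * (2 / r) ^ (n + m) = (4 / r) ^ m * (4 / r) ^ n"
        unfolding power_mult_distrib[symmetric] by (simp add: power_add)
      also have "fact m * B * ((4 / r) ^ m * (4 / r) ^ n) * (r / 8) ^ n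
          = fact m * B * (4 / r) ^ m * ((4 / r) ^ n * (r / 8) ^ n)"
        by (simp only: mult.assoc)
      also have "(4 / r) ^ n * (r / 8) ^ n = (1 / 2) ^ n"
        unfolding power_mult_distrib[symmetric] using r by simp
      also have "fact m * B * (4 / r) ^ m * (1 / 2) ^ n = g n" by (simp only: g_def)
      finally show ?thesis .
    qed
    have "(\<lambda>n. (diffs ^^ m) a n * (x - x0) ^ n) sums (deriv ^^ m) f x"
      using power_series_iterated_deriv[of x0 r a f x m, OF f] x r by simp
    then have "(deriv ^^ m) f x = (\<Sum>n. (diffs ^^ m) a n * (x - x0) ^ n)" by (simp add: sums_iff)
    also have "\<bar>\<dots>\<bar> \<le> (\<Sum>n. g n)"
      using norm_suminf_le[of "\<lambda>n. (diffs ^^ m) a n * (x - x0) ^ n" g] le sums_summable[OF g] by simp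
    also have "\<dots> = 2 * B * fact m * (4 / r) ^ m" using sums_unique[OF g] by (simp add: mult_ac)
    finally show "\<bar>(deriv ^^ m) f x\<bar> \<le> 2 * B * fact m * (4 / r) ^ m" .
  qed
qed

lemma real_analytic_times_cont_diff:
  assumes "real_analytic f"
  shows "times_cont_diff m f"
proof -
  have D: "((deriv ^^ k) f has_real_derivative (deriv ^^ Suc k) f x) (at x)" for k x
  proof -
    obtain r a where r: "r > 0" "\<And>y. \<bar>y - x\<bar> < r \<Longrightarrow> (\<lambda>n. a n * (y - x) ^ n) sums f y"
      using assms unfolding real_analytic_def by blast
    then show ?thesis using power_series_iterated_deriv[of x r a f x k, OF r(2)] by simp
  qed
  have "(deriv ^^ k) f differentiable_on UNIV" for k
    unfolding differentiable_on_def using D[of k] by (auto simp: real_differentiable_def)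
  then show ?thesis
    unfolding times_cont_diff_def using differentiable_imp_continuous_on by blast
qed

text \<open>Finitely many of the local estimates cover one period. Adding up their constants gives bounds that
  dominate all of them, and periodicity carries these over to the whole line.\<close>
lemma real_analytic_deriv_bound:
  assumes per: "periodic_fun_simple f (2 * pi)" and an: "real_analytic f"
  obtains C R where "C > 0" "R > 0" "\<And>m x. \<bar>(deriv ^^ m) f x\<bar> \<le> C * fact m * R ^ m"
proof -
  have "\<exists>r C. r > 0 \<and> C > 0 \<and> (\<forall>m x. \<bar>x - x0\<bar> < r / 8 \<longrightarrow> \<bar>(deriv ^^ m) f x\<bar> \<le> C * fact m * (4 / r) ^ m)" for x0
  proof -
    obtain r a where r: "r > 0" "\<And>y. \<bar>y - x0\<bar> < r \<Longrightarrow> (\<lambda>n. a n * (y - x0) ^ n) sums f y"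
      using an unfolding real_analytic_def by blast
    obtain C where "C > 0" "\<And>m x. \<bar>x - x0\<bar> < r / 8 \<Longrightarrow> \<bar>(deriv ^^ m) f x\<bar> \<le> C * fact m * (4 / r) ^ m"
      using power_series_deriv_bound[OF r] by blast
    with r(1) show ?thesis by blast
  qed
  then obtain r C where rC: "\<And>x0. r x0 > 0" "\<And>x0. C x0 > 0"
    "\<And>x0 m x. \<bar>x - x0\<bar> < r x0 / 8 \<Longrightarrow> \<bar>(deriv ^^ m) f x\<bar> \<le> C x0 * fact m * (4 / r x0) ^ m"
    by metis
  obtain D where D: "finite D" "{0..2 * pi} \<subseteq> (\<Union>c\<in>D. ball c (r c / 8))"
  proof (rule compactE_image[of "{0..2 * pi}" UNIV "\<lambda>c. ball c (r c / 8)"])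
    have "x \<in> ball x (r x / 8)" for x using rC(1)[of x] by simp
    then show "{0..2 * pi} \<subseteq> (\<Union>c. ball c (r c / 8))" by blast
  qed auto
  have D0: "D \<noteq> {}" using D(2) by force
  define C' R' where "C' = (\<Sum>c\<in>D. C c)" and "R' = (\<Sum>c\<in>D. 4 / r c)"
  have pos: "C' > 0" "R' > 0" using D D0 rC by (auto simp: C'_def R'_def intro!: sum_pos)
  have base: "\<bar>(deriv ^^ m) f y\<bar> \<le> C' * fact m * R' ^ m" if y: "y \<in> {0..2 * pi}" for m y
  proof -
    obtain c where c: "c \<in> D" "y \<in> ball c (r c / 8)" using D(2) y by blast
    have "C c \<le> C'" unfolding C'_def using D(1) c(1) rC(2) by (intro member_le_sum) (auto intro: less_imp_le)
    moreover have "4 / r c \<le> R'"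
      unfolding R'_def using D(1) c(1) rC(1) by (intro member_le_sum) (auto intro: less_imp_le)
    ultimately have "C c * fact m * (4 / r c) ^ m \<le> C' * fact m * R' ^ m"
      using rC(1)[of c] rC(2)[of c] pos by (intro mult_mono power_mono) auto
    moreover have "\<bar>(deriv ^^ m) f y\<bar> \<le> C c * fact m * (4 / r c) ^ m"
      using c(2) by (intro rC(3)) (simp add: dist_real_def abs_minus_commute)
    ultimately show ?thesis by linarith
  qed
  have "\<bar>(deriv ^^ m) f x\<bar> \<le> C' * fact m * R' ^ m" for m x
  proof -
    interpret d: periodic_fun_simple "(deriv ^^ m) f" "2 * pi" by (rule periodic_deriv_iterate[OF per])
    obtain y k where "y \<in> {0..2 * pi}" "x = y + of_int k * (2 * pi)" by (rule period_reduction)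
    then show ?thesis using base[of y m] by (simp add: d.plus_of_int)
  qed
  with pos show ?thesis by (rule that)
qed

text \<open>With \<open>n = N / 2\<close> the central estimate is a constant times \<open>(q + 3)! R\<^sup>q\<^sup>+\<^sup>3 n / n\<^sup>q\<close>, which is a polynomial in \<open>n\<close>
  times \<open>(q R / n)\<^sup>q\<close>. Taking \<open>q\<close> to be about \<open>\<epsilon> n\<close> with \<open>\<epsilon> R \<le> 1 / e\<close> bounds the power by a multiple of
  \<open>exp (- \<epsilon> n)\<close>, and half of this decay absorbs the polynomial.\<close>
lemma E_err_analytic:
  assumes per: "periodic_fun_simple f (2 * pi)" and an: "real_analytic f"
  obtains K a where "K > 0" "a > 0" "\<And>N. N > 0 \<Longrightarrow> 4 dvd N \<Longrightarrow> E_err f N \<le> K * exp (- a * real N)"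
proof -
  obtain C R where CR: "C > 0" "R > 0" "\<And>m x. \<bar>(deriv ^^ m) f x\<bar> \<le> C * fact m * R ^ m"
    using real_analytic_deriv_bound[OF per an] by blast
  \<comment> \<open>The minimum with \<open>1\<close> ensures \<open>q \<le> n\<close>, which bounds the polynomial factor.\<close>
  define \<epsilon> where "\<epsilon> = min 1 (exp (- 1) / R)"
  have \<epsilon>: "0 < \<epsilon>" "\<epsilon> \<le> 1" "\<epsilon> * R \<le> exp (- 1)"
  proof -
    have "\<epsilon> \<le> exp (- 1) / R" by (simp add: \<epsilon>_def)
    then show "\<epsilon> * R \<le> exp (- 1)" using CR(2) by (simp add: pos_le_divide_eq)
  qed (use CR(2) in \<open>simp_all add: \<epsilon>_def\<close>)
  define \<delta> where "\<delta> = \<epsilon> / 2"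
  have \<delta>: "\<delta> > 0" "\<epsilon> = 2 * \<delta>" using \<epsilon>(1) by (simp_all add: \<delta>_def)
  define D where "D = 4 * pi\<^sup>2 / 3 * C * R ^ 3 * exp 1"
  have D: "D > 0" using CR by (simp add: D_def)
  show ?thesis
  proof (rule that[of "D * (4 / \<delta>) ^ 4 * exp (3 * \<delta>)" "\<delta> / 2"])
    show "D * (4 / \<delta>) ^ 4 * exp (3 * \<delta>) > 0" "\<delta> / 2 > 0" using D \<delta> by simp_all
    fix N :: nat assume "N > 0" "4 dvd N"
    then obtain K where K: "N = 4 * K" "K > 0" by (auto elim!: dvdE)
    define n where "n = 2 * real K"
    have n: "n > 0" using K by (simp add: n_def)
    define q where "q = nat \<lfloor>\<epsilon> * n\<rfloor>"
    have q: "real q \<le> \<epsilon> * n" "\<epsilon> * n - 1 < real q" using \<epsilon>(1) n unfolding q_def by (simp, linarith)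
    have "\<epsilon> * n \<le> 1 * n" using \<epsilon>(2) n by (intro mult_right_mono) auto
    then have qn: "real q \<le> n" using q(1) by linarith
    have fact_le: "fact (q + 3) \<le> (n + 3) ^ 3 * real q ^ q"
    proof -
      have "fact (q + 3) = (real q + 3) * ((real q + 2) * ((real q + 1) * fact q))"
        by (simp add: numeral_3_eq_3 add_ac)
      also have "\<dots> \<le> (n + 3) * ((n + 3) * ((n + 3) * real q ^ q))"
        using qn fact_le_power[of q, where 'a = real] by (intro mult_mono) auto
      finally show ?thesis by (simp add: power3_eq_cube mult_ac)
    qed
    have decay: "(real q * R / n) ^ q \<le> exp 1 * exp (- \<epsilon> * n)"
    proof -
      have "real q * R / n \<le> \<epsilon> * R" using q(1) n CR(2) by (simp add: field_simps)
      also have "\<dots> \<le> exp (- 1)" by (rule \<epsilon>(3))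
      finally have "(real q * R / n) ^ q \<le> exp (- 1) ^ q"
        using n CR(2) by (intro power_mono) auto
      also have "\<dots> = exp (- real q)" by (simp flip: exp_of_nat_mult)
      also have "\<dots> \<le> exp (1 + - \<epsilon> * n)" using q(2) by simp
      also have "\<dots> = exp 1 * exp (- \<epsilon> * n)" by (rule exp_add)
      finally show ?thesis .
    qed
    \<comment> \<open>the fourth power of \<open>t \<le> exp t\<close> at \<open>t = \<delta> (n + 3) / 4\<close>\<close>
    have poly: "(n + 3) ^ 4 \<le> (4 / \<delta>) ^ 4 * exp (\<delta> * (n + 3))"
    proof -
      have "\<delta> * (n + 3) / 4 \<le> exp (\<delta> * (n + 3) / 4)"
        using exp_ge_add_one_self[of "\<delta> * (n + 3) / 4"] by linarith
      then have "n + 3 \<le> 4 / \<delta> * exp (\<delta> * (n + 3) / 4)" using \<delta>(1) by (simp add: field_simps)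
      then have "(n + 3) ^ 4 \<le> (4 / \<delta> * exp (\<delta> * (n + 3) / 4)) ^ 4" using n by (intro power_mono) auto
      also have "\<dots> = (4 / \<delta>) ^ 4 * exp (\<delta> * (n + 3))"
        unfolding power_mult_distrib by (simp flip: exp_of_nat_mult)
      finally show ?thesis .
    qed
    have "E_err f N \<le> 4 * pi\<^sup>2 / 3 * (C * fact (q + 3) * R ^ (q + 3)) * n / n ^ q"
      unfolding n_def by (rule E_err_smooth[OF K per real_analytic_times_cont_diff[OF an] CR(3)])
    also have "\<dots> \<le> 4 * pi\<^sup>2 / 3 * (C * ((n + 3) ^ 3 * real q ^ q) * R ^ (q + 3)) * (n + 3) / n ^ q"
      using CR n fact_le by (intro divide_right_mono mult_mono order.refl) auto
    also have "\<dots> = 4 * pi\<^sup>2 / 3 * C * R ^ 3 * (n + 3) ^ 4 * (real q * R / n) ^ q"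
    proof -
      have "x ^ 4 = x ^ 3 * x" for x :: real by (simp add: eval_nat_numeral)
      then show ?thesis
        unfolding power_divide power_mult_distrib power_add
        by (simp only: times_divide_eq_right times_divide_eq_left divide_divide_eq_left mult_ac)
    qed
    also have "\<dots> \<le> 4 * pi\<^sup>2 / 3 * C * R ^ 3 * ((4 / \<delta>) ^ 4 * exp (\<delta> * (n + 3))) * (exp 1 * exp (- \<epsilon> * n))"
      using CR n by (intro mult_mono poly decay order.refl) auto
    also have "\<dots> = D * (4 / \<delta>) ^ 4 * (exp (\<delta> * (n + 3)) * exp (- \<epsilon> * n))" by (simp add: D_def mult_ac)
    also have "exp (\<delta> * (n + 3)) * exp (- \<epsilon> * n) = exp (3 * \<delta>) * exp (- (\<delta> / 2) * real N)"
      unfolding exp_add[symmetric] \<delta>(2) n_def K(1) by (simp add: algebra_simps)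
    finally show "E_err f N \<le> D * (4 / \<delta>) ^ 4 * exp (3 * \<delta>) * exp (- (\<delta> / 2) * real N)"
      by (simp add: mult_ac)
  qed
qed

section \<open>Spectral accuracy\<close>

theorem theorem3:
  shows "(\<exists>p :: nat \<Rightarrow> real. filterlim p at_top at_top \<and>
            (\<forall>m\<ge>1. \<forall>f. periodic_fun_simple f (2 * pi) \<and> times_cont_diff m f \<longrightarrow>
               E_err f \<in> O[mult4_at_top](\<lambda>N. mesh N powr p m)))
       \<and> (\<forall>f. periodic_fun_simple f (2 * pi) \<and> real_analytic f \<longrightarrow>
            (\<exists>K a :: real. K > 0 \<and> a > 0 \<and>
               (\<forall>N. N > 0 \<and> 4 dvd N \<longrightarrow> E_err f N \<le> K * exp (- a * real N))))
       \<and> (\<forall>f. trig_polynomial f \<longrightarrow> 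
            (\<exists>N0. \<forall>N\<ge>N0. N > 0 \<and> 4 dvd N \<longrightarrow> E_err f N = 0))"
proof (intro conjI allI impI)
  have "filterlim (\<lambda>m. real m - 4) at_top at_top"
    using filterlim_tendsto_add_at_top[OF tendsto_const filterlim_real_sequentially, of "- 4"] by simp
  then show "\<exists>p :: nat \<Rightarrow> real. filterlim p at_top at_top \<and>
            (\<forall>m\<ge>1. \<forall>f. periodic_fun_simple f (2 * pi) \<and> times_cont_diff m f \<longrightarrow>
               E_err f \<in> O[mult4_at_top](\<lambda>N. mesh N powr p m))"
    using E_err_bigo by blast
next
  fix f assume "periodic_fun_simple f (2 * pi) \<and> real_analytic f"
  then show "\<exists>K a :: real. K > 0 \<and> a > 0 \<and>
               (\<forall>N. N > 0 \<and> 4 dvd N \<longrightarrow> E_err f N \<le> K * exp (- a * real N))"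
    by (metis E_err_analytic)
next
  fix f assume "trig_polynomial f"
  then obtain n a b where "\<And>x. f x = (\<Sum>k\<le>n. a k * cos (real k * x) + b k * sin (real k * x))"
    unfolding trig_polynomial_def by blast
  then have f: "f = trig_sum a b n" by (auto simp: trig_sum_def)
  have "E_err f N = 0" if N: "N \<ge> 2 * n + 1" "4 dvd N" for N
  proof -
    obtain K where K: "N = 4 * K" using N(2) by (auto elim!: dvdE)
    then show ?thesis unfolding f using N(1) by (intro E_err_trig_sum[OF K]) auto
  qed
  then show "\<exists>N0. \<forall>N\<ge>N0. N > 0 \<and> 4 dvd N \<longrightarrow> E_err f N = 0" by blast
qed

end
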